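(* Let $T$ be a complete theory in a countable language $L$ with definable Skolem functions, and let $\mathfrak p$ be a symmetric strongly regular global type of $T$. Then $T$ has quasiminimal models of arbitrarily large cardinalities.
   Context: $\mathfrak C$ is a monster model of $T$. $T$ has definable Skolem functions if for every $L$-formula $\phi(y,\bar x)$ there is an $\emptyset$-definable function $f_\phi(\bar x)$ with $T\models \forall \bar x(\exists y\,\phi(y,\bar x)\to\phi(f_\phi(\bar x),\bar x))$. A global type $\mathfrak p(x)$ (complete type in one variable over $\mathfrak C$) is strongly regular if it is invariant under $\mathrm{Aut}(\mathfrak C)$ and for every small $B\subseteq\mathfrak C$ and $a\in\mathfrak C$, either $a$ realises $\mathfrak p|_B$ or $\mathfrak p|_B\vdash\mathfrak p|_{B\cup\{a\}}$. A Morley sequence in $\mathfrak p$ is a sequence $(a_i)_{i<\alpha}$ with $a_i$ realising $\mathfrak p|_{\{a_j:j<i\}}$; $\mathfrak p$ is symmetric if its Morley sequences are totally indiscernible. A structure is quasiminimal if it is uncountable and every subset definable with parameters is countable or co-countable.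
   Formalization: The type p is additionally assumed nonalgebraic; otherwise the type of a ∅-definable element (e.g. tp(0) in real closed fields) is symmetric and strongly regular although T has no quasiminimal model. *)

theory Defs
  imports "HOL-Library.Countable_Set"
begin

unbundle cardinal_syntax

section \<open>First-order logic with equality\<close>

text \<open>A language is carried by sets of symbols, so that it may lack function or relation symbols
  altogether; constants are function symbols of arity 0.\<close>

record ('f, 'r) language =
  fsyms :: "'f set"
  rsyms :: "'r set"
  farity :: "'f \<Rightarrow> nat"
  rarity :: "'r \<Rightarrow> nat"

definition countable_language :: "('f, 'r) language \<Rightarrow> bool" where
  "countable_language L \<longleftrightarrow> countable (fsyms L) \<and> countable (rsyms L)"

datatype 'f trm = Var nat | Fn 'f "'f trm list"

datatype ('f, 'r) fm =
    Eq "'f trm" "'f trm"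
  | Rel 'r "'f trm list"
  | Neg "('f, 'r) fm"
  | And "('f, 'r) fm" "('f, 'r) fm"
  | Ex nat "('f, 'r) fm"

primrec wf_trm :: "('f, 'r) language \<Rightarrow> 'f trm \<Rightarrow> bool" where
  "wf_trm L (Var n) \<longleftrightarrow> True"
| "wf_trm L (Fn f ts) \<longleftrightarrow> f \<in> fsyms L \<and> length ts = farity L f \<and> list_all (wf_trm L) ts"

primrec wf_fm :: "('f, 'r) language \<Rightarrow> ('f, 'r) fm \<Rightarrow> bool" where
  "wf_fm L (Eq s t) \<longleftrightarrow> wf_trm L s \<and> wf_trm L t"
| "wf_fm L (Rel R ts) \<longleftrightarrow> R \<in> rsyms L \<and> length ts = rarity L R \<and> list_all (wf_trm L) ts"
| "wf_fm L (Neg \<phi>) \<longleftrightarrow> wf_fm L \<phi>"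
| "wf_fm L (And \<phi> \<psi>) \<longleftrightarrow> wf_fm L \<phi> \<and> wf_fm L \<psi>"
| "wf_fm L (Ex n \<phi>) \<longleftrightarrow> wf_fm L \<phi>"

primrec vars_trm :: "'f trm \<Rightarrow> nat set" where
  "vars_trm (Var n) = {n}"
| "vars_trm (Fn f ts) = \<Union> (set (map vars_trm ts))"

primrec fv :: "('f, 'r) fm \<Rightarrow> nat set" where
  "fv (Eq s t) = vars_trm s \<union> vars_trm t"
| "fv (Rel R ts) = \<Union> (set (map vars_trm ts))"
| "fv (Neg \<phi>) = fv \<phi>"
| "fv (And \<phi> \<psi>) = fv \<phi> \<union> fv \<psi>"
| "fv (Ex n \<phi>) = fv \<phi> - {n}"

record ('f, 'r, 'a) fo_struct =
  univ :: "'a set"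
  fint :: "'f \<Rightarrow> 'a list \<Rightarrow> 'a"
  rint :: "'r \<Rightarrow> 'a list \<Rightarrow> bool"

definition is_structure :: "('f, 'r) language \<Rightarrow> ('f, 'r, 'a) fo_struct \<Rightarrow> bool" where
  "is_structure L M \<longleftrightarrow> univ M \<noteq> {} \<and>
     (\<forall>f\<in>fsyms L. \<forall>as. length as = farity L f \<and> set as \<subseteq> univ M \<longrightarrow> fint M f as \<in> univ M)"

primrec eval_trm :: "('f, 'r, 'a) fo_struct \<Rightarrow> (nat \<Rightarrow> 'a) \<Rightarrow> 'f trm \<Rightarrow> 'a" where
  "eval_trm M e (Var n) = e n"
| "eval_trm M e (Fn f ts) = fint M f (map (eval_trm M e) ts)"

primrec sat :: "('f, 'r, 'a) fo_struct \<Rightarrow> (nat \<Rightarrow> 'a) \<Rightarrow> ('f, 'r) fm \<Rightarrow> bool" where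
  "sat M e (Eq s t) \<longleftrightarrow> eval_trm M e s = eval_trm M e t"
| "sat M e (Rel R ts) \<longleftrightarrow> rint M R (map (eval_trm M e) ts)"
| "sat M e (Neg \<phi>) \<longleftrightarrow> \<not> sat M e \<phi>"
| "sat M e (And \<phi> \<psi>) \<longleftrightarrow> sat M e \<phi> \<and> sat M e \<psi>"
| "sat M e (Ex n \<phi>) \<longleftrightarrow> (\<exists>a\<in>univ M. sat M (e(n := a)) \<phi>)"

text \<open>\<open>formulas L n\<close> are the \<open>L\<close>-formulas in the free variables \<open>0, \<dots>, n - 1\<close>; \<open>holds M \<phi> as\<close>
  evaluates such a formula at an \<open>n\<close>-tuple, and the value outside the tuple is irrelevant.\<close>

definition formulas :: "('f, 'r) language \<Rightarrow> nat \<Rightarrow> ('f, 'r) fm set" where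
  "formulas L n = {\<phi>. wf_fm L \<phi> \<and> fv \<phi> \<subseteq> {..<n}}"

definition holds :: "('f, 'r, 'a) fo_struct \<Rightarrow> ('f, 'r) fm \<Rightarrow> 'a list \<Rightarrow> bool" where
  "holds M \<phi> as \<longleftrightarrow> sat M (\<lambda>i. if i < length as then as ! i else undefined) \<phi>"


section \<open>Theories\<close>

definition model :: "('f, 'r) language \<Rightarrow> ('f, 'r) fm set \<Rightarrow> ('f, 'r, 'a) fo_struct \<Rightarrow> bool" where
  "model L T M \<longleftrightarrow> is_structure L M \<and> (\<forall>\<phi>\<in>T. holds M \<phi> [])"

text \<open>Quantification over all models of a theory is rendered as quantification over the models
  whose universe is a set of elements of type \<open>('f, 'r) fm\<close>.  This type is infinite and has at
  least as many elements as there are \<open>L\<close>-formulas, so by the downward Loewenheim-Skolem theorem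
  every structure has an elementary substructure that is isomorphic to one of this kind.\<close>

type_synonym ('f, 'r) test_struct = "('f, 'r, ('f, 'r) fm) fo_struct"

definition entails :: "('f, 'r) language \<Rightarrow> ('f, 'r) fm set \<Rightarrow> ('f, 'r) fm \<Rightarrow> bool" where
  "entails L T \<phi> \<longleftrightarrow> (\<forall>M :: ('f, 'r) test_struct. model L T M \<longrightarrow> holds M \<phi> [])"

definition complete_theory :: "('f, 'r) language \<Rightarrow> ('f, 'r) fm set \<Rightarrow> bool" where
  "complete_theory L T \<longleftrightarrow>
     T \<subseteq> formulas L 0 \<and>
     (\<exists>M :: ('f, 'r) test_struct. model L T M) \<and>
     (\<forall>\<phi>\<in>formulas L 0. entails L T \<phi> \<or> entails L T (Neg \<phi>))"

text \<open>In \<open>\<phi>(y, x\<^sub>1, \<dots>, x\<^sub>n)\<close> the variable \<open>y\<close> is variable 0 and \<open>x\<^sub>i\<close> is variable \<open>i\<close> (the tuple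
  may be empty).  The formula \<open>\<psi>(y, x\<^sub>1, \<dots>, x\<^sub>n)\<close> defines the graph of the function \<open>f\<^sub>\<phi>\<close>.\<close>

definition definable_skolem_functions :: "('f, 'r) language \<Rightarrow> ('f, 'r) fm set \<Rightarrow> bool" where
  "definable_skolem_functions L T \<longleftrightarrow>
     (\<forall>n. \<forall>\<phi>\<in>formulas L (Suc n). \<exists>\<psi>\<in>formulas L (Suc n).
        \<forall>M :: ('f, 'r) test_struct. model L T M \<longrightarrow>
          (\<forall>xs. length xs = n \<and> set xs \<subseteq> univ M \<longrightarrow>
             (\<exists>!y. y \<in> univ M \<and> holds M \<psi> (y # xs)) \<and>
             ((\<exists>y\<in>univ M. holds M \<phi> (y # xs)) \<longrightarrow>
              (\<forall>y\<in>univ M. holds M \<psi> (y # xs) \<longrightarrow> holds M \<phi> (y # xs)))))"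


section \<open>Types in one variable\<close>

text \<open>A formula \<open>\<phi>(x, b\<^sub>1, \<dots>, b\<^sub>n)\<close> with parameters is the pair of \<open>\<phi>\<close> and the list of the \<open>b\<^sub>i\<close>;
  \<open>x\<close> is variable 0 and \<open>b\<^sub>i\<close> is substituted for variable \<open>i\<close>.\<close>

type_synonym ('f, 'r, 'a) pfm = "('f, 'r) fm \<times> 'a list"

definition pformulas :: "('f, 'r) language \<Rightarrow> 'a set \<Rightarrow> ('f, 'r, 'a) pfm set" where
  "pformulas L B = {(\<phi>, bs). \<phi> \<in> formulas L (Suc (length bs)) \<and> set bs \<subseteq> B}"

definition solutions :: "('f, 'r, 'a) fo_struct \<Rightarrow> ('f, 'r, 'a) pfm \<Rightarrow> 'a set" where
  "solutions M = (\<lambda>(\<phi>, bs). {a \<in> univ M. holds M \<phi> (a # bs)})"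

definition realises :: "('f, 'r, 'a) fo_struct \<Rightarrow> 'a \<Rightarrow> ('f, 'r, 'a) pfm set \<Rightarrow> bool" where
  "realises M a \<pi> \<longleftrightarrow> a \<in> univ M \<and> (\<forall>\<theta>\<in>\<pi>. a \<in> solutions M \<theta>)"

definition complete_type ::
  "('f, 'r) language \<Rightarrow> ('f, 'r, 'a) fo_struct \<Rightarrow> 'a set \<Rightarrow> ('f, 'r, 'a) pfm set \<Rightarrow> bool" where
  "complete_type L M B \<pi> \<longleftrightarrow>
     \<pi> \<subseteq> pformulas L B \<and>
     (\<forall>F. finite F \<and> F \<subseteq> \<pi> \<longrightarrow> (\<exists>a. realises M a F)) \<and>
     (\<forall>(\<phi>, bs)\<in>pformulas L B. (\<phi>, bs) \<in> \<pi> \<or> (Neg \<phi>, bs) \<in> \<pi>)"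

definition restrict_type :: "('f, 'r, 'a) pfm set \<Rightarrow> 'a set \<Rightarrow> ('f, 'r, 'a) pfm set"
    (infixl "\<restriction>\<restriction>" 95) where
  "\<pi> \<restriction>\<restriction> B = {(\<phi>, bs) \<in> \<pi>. set bs \<subseteq> B}"

text \<open>Regular types are understood to be nonalgebraic.  The type of
  an \<open>\<emptyset>\<close>-definable element, whose Morley sequences are constant, would otherwise be strongly
  regular and symmetric for trivial reasons.\<close>

definition nonalgebraic :: "('f, 'r, 'a) fo_struct \<Rightarrow> ('f, 'r, 'a) pfm set \<Rightarrow> bool" where
  "nonalgebraic M \<pi> \<longleftrightarrow> (\<forall>\<theta>\<in>\<pi>. infinite (solutions M \<theta>))"


section \<open>Monster models\<close>

definition automorphism ::
  "('f, 'r) language \<Rightarrow> ('f, 'r, 'a) fo_struct \<Rightarrow> ('a \<Rightarrow> 'a) \<Rightarrow> bool" where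
  "automorphism L M \<sigma> \<longleftrightarrow>
     bij_betw \<sigma> (univ M) (univ M) \<and>
     (\<forall>f\<in>fsyms L. \<forall>as. length as = farity L f \<and> set as \<subseteq> univ M \<longrightarrow>
        \<sigma> (fint M f as) = fint M f (map \<sigma> as)) \<and>
     (\<forall>R\<in>rsyms L. \<forall>as. length as = rarity L R \<and> set as \<subseteq> univ M \<longrightarrow>
        rint M R as = rint M R (map \<sigma> as))"

definition partial_elementary ::
  "('f, 'r) language \<Rightarrow> ('f, 'r, 'a) fo_struct \<Rightarrow> 'a set \<Rightarrow> ('a \<Rightarrow> 'a) \<Rightarrow> bool" where
  "partial_elementary L M A f \<longleftrightarrow> f ` A \<subseteq> univ M \<and>
     (\<forall>as. set as \<subseteq> A \<longrightarrow>
        (\<forall>\<phi>\<in>formulas L (length as). holds M \<phi> as \<longleftrightarrow> holds M \<phi> (map f as)))"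

definition small :: "'c rel \<Rightarrow> 'a set \<Rightarrow> bool" where
  "small \<kappa> A \<longleftrightarrow> |A| <o \<kappa>"

definition saturated :: "('f, 'r) language \<Rightarrow> 'c rel \<Rightarrow> ('f, 'r, 'a) fo_struct \<Rightarrow> bool" where
  "saturated L \<kappa> M \<longleftrightarrow>
     (\<forall>A \<pi>. A \<subseteq> univ M \<and> small \<kappa> A \<and> complete_type L M A \<pi> \<longrightarrow> (\<exists>a. realises M a \<pi>))"

definition strongly_homogeneous ::
  "('f, 'r) language \<Rightarrow> 'c rel \<Rightarrow> ('f, 'r, 'a) fo_struct \<Rightarrow> bool" where
  "strongly_homogeneous L \<kappa> M \<longleftrightarrow>
     (\<forall>A f. A \<subseteq> univ M \<and> small \<kappa> A \<and> partial_elementary L M A f \<longrightarrow>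
        (\<exists>\<sigma>. automorphism L M \<sigma> \<and> (\<forall>a\<in>A. \<sigma> a = f a)))"

text \<open>The cardinal \<open>\<kappa>\<close> fixes the meaning of ``small''.  For a countable language nothing more than
  its uncountability is demanded; larger \<open>\<kappa>\<close> are of course covered.\<close>

definition monster_model ::
  "('f, 'r) language \<Rightarrow> ('f, 'r) fm set \<Rightarrow> 'c rel \<Rightarrow> ('f, 'r, 'a) fo_struct \<Rightarrow> bool" where
  "monster_model L T \<kappa> C \<longleftrightarrow>
     Card_order \<kappa> \<and> natLeq <o \<kappa> \<and>
     model L T C \<and> saturated L \<kappa> C \<and> strongly_homogeneous L \<kappa> C"


section \<open>Global types\<close>

definition global_type ::
  "('f, 'r) language \<Rightarrow> ('f, 'r, 'a) fo_struct \<Rightarrow> ('f, 'r, 'a) pfm set \<Rightarrow> bool" where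
  "global_type L C p \<longleftrightarrow> complete_type L C (univ C) p"

definition invariant_type ::
  "('f, 'r) language \<Rightarrow> ('f, 'r, 'a) fo_struct \<Rightarrow> ('f, 'r, 'a) pfm set \<Rightarrow> bool" where
  "invariant_type L C p \<longleftrightarrow>
     (\<forall>\<sigma>. automorphism L C \<sigma> \<longrightarrow>
        (\<forall>(\<phi>, bs)\<in>pformulas L (univ C). (\<phi>, bs) \<in> p \<longleftrightarrow> (\<phi>, map \<sigma> bs) \<in> p))"

text \<open>\<open>\<pi> \<turnstile> \<pi>'\<close> for types over small subsets of the monster model \<open>C\<close>, as usual in terms of their
  realisations in \<open>C\<close>.\<close>

definition implies_type ::
  "('f, 'r, 'a) fo_struct \<Rightarrow> ('f, 'r, 'a) pfm set \<Rightarrow> ('f, 'r, 'a) pfm set \<Rightarrow> bool" where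
  "implies_type C \<pi> \<pi>' \<longleftrightarrow> (\<forall>a. realises C a \<pi> \<longrightarrow> realises C a \<pi>')"

definition strongly_regular ::
  "('f, 'r) language \<Rightarrow> 'c rel \<Rightarrow> ('f, 'r, 'a) fo_struct \<Rightarrow> ('f, 'r, 'a) pfm set \<Rightarrow> bool" where
  "strongly_regular L \<kappa> C p \<longleftrightarrow>
     invariant_type L C p \<and>
     (\<forall>B a. B \<subseteq> univ C \<and> small \<kappa> B \<and> a \<in> univ C \<longrightarrow>
        realises C a (p \<restriction>\<restriction> B) \<or> implies_type C (p \<restriction>\<restriction> B) (p \<restriction>\<restriction> (B \<union> {a})))"

text \<open>The index ordinal of a sequence is given as a well-order \<open>r\<close> on its field.\<close>

definition morley_sequence ::
  "('f, 'r, 'a) fo_struct \<Rightarrow> ('f, 'r, 'a) pfm set \<Rightarrow> 'i rel \<Rightarrow> ('i \<Rightarrow> 'a) \<Rightarrow> bool" where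
  "morley_sequence C p r a \<longleftrightarrow>
     Well_order r \<and> (\<forall>i\<in>Field r. realises C (a i) (p \<restriction>\<restriction> (a ` underS r i)))"

definition totally_indiscernible ::
  "('f, 'r) language \<Rightarrow> ('f, 'r, 'a) fo_struct \<Rightarrow> 'i set \<Rightarrow> ('i \<Rightarrow> 'a) \<Rightarrow> bool" where
  "totally_indiscernible L C I a \<longleftrightarrow>
     (\<forall>is js. distinct is \<and> distinct js \<and> length is = length js \<and> set is \<subseteq> I \<and> set js \<subseteq> I \<longrightarrow>
        (\<forall>\<phi>\<in>formulas L (length is). holds C \<phi> (map a is) \<longleftrightarrow> holds C \<phi> (map a js)))"

text \<open>For a nonalgebraic type, Morley sequences are injective, so that well-orders on the type of
  the elements of \<open>C\<close> provide index sets for all of them.\<close>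

definition symmetric_type ::
  "('f, 'r) language \<Rightarrow> ('f, 'r, 'a) fo_struct \<Rightarrow> ('f, 'r, 'a) pfm set \<Rightarrow> bool" where
  "symmetric_type L C p \<longleftrightarrow>
     (\<forall>(r :: 'a rel) a. morley_sequence C p r a \<longrightarrow> totally_indiscernible L C (Field r) a)"


section \<open>Quasiminimality\<close>

definition definable_subset ::
  "('f, 'r) language \<Rightarrow> ('f, 'r, 'a) fo_struct \<Rightarrow> 'a set \<Rightarrow> bool" where
  "definable_subset L M D \<longleftrightarrow> (\<exists>\<theta>\<in>pformulas L (univ M). D = solutions M \<theta>)"

definition quasiminimal :: "('f, 'r) language \<Rightarrow> ('f, 'r, 'a) fo_struct \<Rightarrow> bool" where
  "quasiminimal L M \<longleftrightarrow>
     uncountable (univ M) \<and>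
     (\<forall>D. definable_subset L M D \<longrightarrow> countable D \<or> countable (univ M - D))"

end

theory Submission
  imports Defs
begin

text \<open>Let \<open>(a\<^sub>n)\<close> be a Morley sequence of \<open>p\<close> in \<open>C\<close>.  It is totally indiscernible, so its Skolem
  hull can be stretched: for every set \<open>X\<close> there is a model \<open>M\<close> that is the definable closure of a
  totally indiscernible set indexed by \<open>X\<close>, all of whose finitely generated parts embed elementarily
  into \<open>C\<close> through injections from finite subsets of \<open>X\<close> to the indices \<open>n\<close>.

  Let \<open>D \<subseteq> M\<close> be definable over a finite \<open>S \<subseteq> X\<close> by a formula that is not in \<open>p\<close>, and let
  \<open>y = f(S, x\<^sub>1, \<dots>, x\<^sub>n) \<in> D\<close> with \<open>x\<^sub>1, \<dots>, x\<^sub>n \<in> X - S\<close>.  As \<open>y\<close> does not realise \<open>p\<close> over \<open>S\<close>,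
  regularity makes every Morley sequence over \<open>S\<close> one over \<open>S \<union> {y}\<close>.  By invariance of \<open>p\<close> all of
  these have the same type over \<open>S \<union> {y}\<close>, so \<open>y\<close> depends only on \<open>f\<close>, for which there are
  countably many choices.  Therefore \<open>D\<close> is countable, and of any definable set and its complement
  one is countable.\<close>

section \<open>Formulas and automorphisms\<close>

text \<open>The model may have to be larger than \<open>C\<close>, of which only saturation and
  homogeneity for some uncountable \<open>\<kappa>\<close> are known, so the hull of the long
  indiscernible set cannot be formed inside \<open>C\<close>. It is assembled from formal
  definitions with finitely many parameters in the index set; two of them are identified when they
  denote the same point of \<open>C\<close> once the parameters are sent into the Morley sequence.
  Total indiscernibility makes every injection of the parameters admissible: the index set needs no
  order, and any two evaluations differ by an automorphism of \<open>C\<close>. Countability of a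
  small definable set is obtained by replacing the parameters of each definition by elements of one
  fixed countable set without moving the point, so the whole set lies in a countable hull. The
  Skolem functions make definable closures elementary substructures. They are granted for models
  whose elements are formulas, so a Loewenheim-Skolem argument has to transfer them to
  \<open>C\<close>.\<close>

lemma eval_trm_cong:
  "(\<And>i. i \<in> vars_trm t \<Longrightarrow> e i = e' i) \<Longrightarrow> eval_trm M e t = eval_trm M e' t"
proof (induction t)
  case (Fn f ts)
  then have "map (eval_trm M e) ts = map (eval_trm M e') ts"
    by (intro map_cong) auto
  then show ?case by (metis eval_trm.simps(2))
qed simp

lemma map_eval_trm_cong:
  assumes "\<And>i. i \<in> \<Union> (set (map vars_trm ts)) \<Longrightarrow> e i = e' i"
  shows "map (eval_trm M e) ts = map (eval_trm M e') ts"
  using assms by (intro map_cong eval_trm_cong) auto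

lemma sat_cong: "(\<And>i. i \<in> fv \<phi> \<Longrightarrow> e i = e' i) \<Longrightarrow> sat M e \<phi> \<longleftrightarrow> sat M e' \<phi>"
proof (induction \<phi> arbitrary: e e')
  case (Eq s t)
  then show ?case using eval_trm_cong[of s e e' M] eval_trm_cong[of t e e' M] by simp
next
  case (Rel R ts)
  then have "map (eval_trm M e) ts = map (eval_trm M e') ts"
    by (intro map_eval_trm_cong) auto
  then show ?case by (metis sat.simps(2))
next
  case (Neg \<phi>)
  then show ?case by (metis fv.simps(3) sat.simps(3))
next
  case (And \<phi>1 \<phi>2)
  then show ?case by (metis UnCI fv.simps(4) sat.simps(4))
next
  case (Ex n \<phi>)
  have "sat M (e(n := a)) \<phi> \<longleftrightarrow> sat M (e'(n := a)) \<phi>" for a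
    using Ex.prems by (intro Ex.IH) auto
  then show ?case by simp
qed

lemma finite_vars_trm: "finite (vars_trm t)"
  by (induction t) auto

lemma finite_fv: "finite (fv \<phi>)"
  by (induction \<phi>) (auto simp: finite_vars_trm)

section \<open>Renaming of free variables\<close>

primrec rename_trm :: "(nat \<Rightarrow> nat) \<Rightarrow> 'f trm \<Rightarrow> 'f trm" where
  "rename_trm g (Var n) = Var (g n)"
| "rename_trm g (Fn f ts) = Fn f (map (rename_trm g) ts)"

text \<open>Under a quantifier the bound variable becomes the least index outside the image of the
  free variables, which rules out capture. The map follows the formula as an argument because the
  recursion continues with an updated map.\<close>

primrec rename :: "('f, 'r) fm \<Rightarrow> (nat \<Rightarrow> nat) \<Rightarrow> ('f, 'r) fm" where
  "rename (Eq s t) = (\<lambda>g. Eq (rename_trm g s) (rename_trm g t))"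
| "rename (Rel R ts) = (\<lambda>g. Rel R (map (rename_trm g) ts))"
| "rename (Neg \<phi>) = (\<lambda>g. Neg (rename \<phi> g))"
| "rename (And \<phi> \<psi>) = (\<lambda>g. And (rename \<phi> g) (rename \<psi> g))"
| "rename (Ex n \<phi>) = (\<lambda>g. let m = (LEAST m. m \<notin> g ` fv \<phi>) in Ex m (rename \<phi> (g(n := m))))"

lemma Least_not_in_image_fv: "(LEAST m :: nat. m \<notin> g ` fv \<phi>) \<notin> g ` fv \<phi>"
proof -
  have "finite (g ` fv \<phi>)" by (simp add: finite_fv)
  then show ?thesis by (metis (mono_tags, lifting) LeastI_ex ex_new_if_finite infinite_UNIV_nat)
qed

lemma eval_rename_trm: "eval_trm M e (rename_trm g t) = eval_trm M (\<lambda>i. e (g i)) t"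
  by (induction t) (auto simp: comp_def cong: map_cong)

lemma wf_rename_trm: "wf_trm L (rename_trm g t) = wf_trm L t"
  by (induction t) (auto simp: list_all_iff)

lemma vars_rename_trm: "vars_trm (rename_trm g t) = g ` vars_trm t"
  by (induction t) auto

lemma sat_rename: "sat M e (rename \<phi> g) \<longleftrightarrow> sat M (\<lambda>i. e (g i)) \<phi>"
proof (induction \<phi> arbitrary: e g)
  case (Eq s t)
  then show ?case by (simp add: eval_rename_trm)
next
  case (Rel R ts)
  then show ?case by (simp add: eval_rename_trm comp_def)
next
  case (Ex n \<phi>)
  define m where "m = (LEAST m. m \<notin> g ` fv \<phi>)"
  have m: "m \<notin> g ` fv \<phi>" unfolding m_def by (rule Least_not_in_image_fv)
  \<comment> \<open>The environments agree on \<open>fv \<phi>\<close>: at \<open>n\<close> both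
    give \<open>a\<close>, elsewhere \<open>g\<close> avoids \<open>m\<close>.\<close>
  have "sat M (\<lambda>i. (e(m := a)) ((g(n := m)) i)) \<phi> \<longleftrightarrow> sat M ((\<lambda>i. e (g i))(n := a)) \<phi>" for a
    using m by (intro sat_cong) auto
  then show ?case using Ex.IH by (simp add: m_def[symmetric])
qed auto

lemma wf_rename: "wf_fm L (rename \<phi> g) = wf_fm L \<phi>"
  by (induction \<phi> arbitrary: g) (auto simp: wf_rename_trm list_all_iff Let_def)

lemma fv_rename: "fv (rename \<phi> g) \<subseteq> g ` fv \<phi>"
proof (induction \<phi> arbitrary: g)
  case (Ex n \<phi>)
  define m where "m = (LEAST m. m \<notin> g ` fv \<phi>)"
  have "fv (rename (Ex n \<phi>) g) = fv (rename \<phi> (g(n := m))) - {m}" by (simp add: m_def Let_def)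
  also have "\<dots> \<subseteq> (g(n := m)) ` fv \<phi> - {m}" using Ex.IH by blast
  also have "\<dots> \<subseteq> g ` fv (Ex n \<phi>)" by auto
  finally show ?case .
next
  case (And \<phi>1 \<phi>2)
  then show ?case by simp blast
qed (auto simp: vars_rename_trm)

text \<open>Beyond the tuple, \<open>holds\<close> uses \<open>undefined\<close>, which may lie
  outside the universe. Any environment that extends the tuple can take its place, in particular one
  with all values in the universe, as the inductions on \<open>sat\<close> require.\<close>

lemma holds_iff_sat:
  assumes "fv \<phi> \<subseteq> {..<length as}" "\<And>i. i < length as \<Longrightarrow> e i = as ! i"
  shows "holds M \<phi> as \<longleftrightarrow> sat M e \<phi>"
  unfolding holds_def using assms by (intro sat_cong) auto

lemma holds_iff_sat_formula:
  assumes "\<phi> \<in> formulas L (length as)" "\<And>i. i < length as \<Longrightarrow> e i = as ! i"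
  shows "holds M \<phi> as \<longleftrightarrow> sat M e \<phi>"
  using assms by (intro holds_iff_sat) (auto simp: formulas_def)

lemma holds_Neg [simp]: "holds M (Neg \<phi>) as \<longleftrightarrow> \<not> holds M \<phi> as"
  by (simp add: holds_def)

lemma solutions_Neg: "solutions M (Neg \<phi>, bs) = univ M - solutions M (\<phi>, bs)"
  by (auto simp: solutions_def)

lemma formulas_Neg [simp]: "Neg \<phi> \<in> formulas L n \<longleftrightarrow> \<phi> \<in> formulas L n"
  by (simp add: formulas_def)

lemma rename_in_formulas:
  assumes "\<phi> \<in> formulas L n" "\<And>i. i < n \<Longrightarrow> g i < m"
  shows "rename \<phi> g \<in> formulas L m"
  using assms fv_rename[of \<phi> g] by (force simp: formulas_def wf_rename)

lemma holds_rename: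
  assumes "\<phi> \<in> formulas L (length as)" "\<And>i. i < length as \<Longrightarrow> g i < length bs \<and> as ! i = bs ! g i"
  shows "holds M (rename \<phi> g) bs \<longleftrightarrow> holds M \<phi> as"
proof -
  have "rename \<phi> g \<in> formulas L (length bs)" using rename_in_formulas[OF assms(1)] assms(2) by blast
  then have "holds M (rename \<phi> g) bs \<longleftrightarrow> sat M (\<lambda>i. bs ! i) (rename \<phi> g)"
    by (rule holds_iff_sat_formula) simp
  also have "\<dots> \<longleftrightarrow> sat M (\<lambda>i. bs ! g i) \<phi>" by (rule sat_rename)
  also have "\<dots> \<longleftrightarrow> holds M \<phi> as"
    using assms by (intro holds_iff_sat_formula[symmetric, where L=L]) auto
  finally show ?thesis .
qed

section \<open>Automorphisms preserve satisfaction\<close>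

lemma eval_trm_in_univ:
  assumes "is_structure L M" "range e \<subseteq> univ M"
  shows "wf_trm L t \<Longrightarrow> eval_trm M e t \<in> univ M"
proof (induction t)
  case (Fn f ts)
  then have "set (map (eval_trm M e) ts) \<subseteq> univ M" by (auto simp: list_all_iff)
  then show ?case using Fn.prems assms(1) unfolding is_structure_def by auto
qed (use assms in auto)

lemma map_eval_trm_in_univ:
  assumes "is_structure L M" "range e \<subseteq> univ M" "list_all (wf_trm L) ts"
  shows "set (map (eval_trm M e) ts) \<subseteq> univ M"
  using eval_trm_in_univ[OF assms(1,2)] assms(3) by (auto simp: list_all_iff)

lemma automorphism_in_univ: "automorphism L M \<sigma> \<Longrightarrow> a \<in> univ M \<Longrightarrow> \<sigma> a \<in> univ M"
  by (auto simp: automorphism_def bij_betw_def)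

lemma automorphism_inj:
  "automorphism L M \<sigma> \<Longrightarrow> a \<in> univ M \<Longrightarrow> b \<in> univ M \<Longrightarrow> \<sigma> a = \<sigma> b \<longleftrightarrow> a = b"
  by (auto simp: automorphism_def bij_betw_def inj_on_def)

lemma automorphism_eval_trm:
  assumes "is_structure L M" "automorphism L M \<sigma>" "range e \<subseteq> univ M"
  shows "wf_trm L t \<Longrightarrow> eval_trm M (\<lambda>i. \<sigma> (e i)) t = \<sigma> (eval_trm M e t)"
proof (induction t)
  case (Fn f ts)
  have "eval_trm M (\<lambda>i. \<sigma> (e i)) t = \<sigma> (eval_trm M e t)" if "t \<in> set ts" for t
    using Fn that by (auto simp only: list_all_iff wf_trm.simps)
  then have eq: "map (eval_trm M (\<lambda>i. \<sigma> (e i))) ts = map \<sigma> (map (eval_trm M e) ts)" by simp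
  have "set (map (eval_trm M e) ts) \<subseteq> univ M"
    using Fn.prems by (intro map_eval_trm_in_univ[OF assms(1,3)]) simp
  then have "\<sigma> (fint M f (map (eval_trm M e) ts)) = fint M f (map \<sigma> (map (eval_trm M e) ts))"
    using assms(2) Fn.prems unfolding automorphism_def by auto
  then show ?case unfolding eval_trm.simps eq by simp
qed simp

lemma automorphism_sat:
  assumes "is_structure L M" "automorphism L M \<sigma>"
  shows "wf_fm L \<phi> \<Longrightarrow> range e \<subseteq> univ M \<Longrightarrow> sat M (\<lambda>i. \<sigma> (e i)) \<phi> \<longleftrightarrow> sat M e \<phi>"
proof (induction \<phi> arbitrary: e)
  case (Eq s t)
  then have wf: "wf_trm L s" "wf_trm L t" by simp_all
  show ?case unfolding sat.simps automorphism_eval_trm[OF assms Eq.prems(2) wf(1)]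
      automorphism_eval_trm[OF assms Eq.prems(2) wf(2)]
    using wf eval_trm_in_univ[OF assms(1) Eq.prems(2)] automorphism_inj[OF assms(2)] by blast
next
  case (Rel R ts)
  have eq: "map (eval_trm M (\<lambda>i. \<sigma> (e i))) ts = map \<sigma> (map (eval_trm M e) ts)"
    using Rel.prems(1) automorphism_eval_trm[OF assms Rel.prems(2)]
    by (simp add: list_all_iff)
  have "set (map (eval_trm M e) ts) \<subseteq> univ M"
    using Rel.prems(1) by (intro map_eval_trm_in_univ[OF assms(1) Rel.prems(2)]) simp
  then have "rint M R (map (eval_trm M e) ts) \<longleftrightarrow> rint M R (map \<sigma> (map (eval_trm M e) ts))"
    using assms(2) Rel.prems unfolding automorphism_def by auto
  then show ?case unfolding sat.simps eq by simp
next
  case (Ex n \<phi>)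
  have *: "sat M (\<lambda>i. \<sigma> ((e(n := a)) i)) \<phi> \<longleftrightarrow> sat M (e(n := a)) \<phi>" if "a \<in> univ M" for a
    using Ex.prems that by (intro Ex.IH) auto
  have "(\<lambda>i. \<sigma> (e i))(n := \<sigma> a) = (\<lambda>i. \<sigma> ((e(n := a)) i))" for a by auto
  \<comment> \<open>Surjectivity of \<open>\<sigma>\<close> lets every witness for the moved
    environment be written as the image of some element.\<close>
  moreover have "univ M = \<sigma> ` univ M" using assms(2) by (simp add: automorphism_def bij_betw_def)
  then have "(\<exists>a\<in>univ M. sat M ((\<lambda>i. \<sigma> (e i))(n := a)) \<phi>) \<longleftrightarrow>
      (\<exists>a\<in>univ M. sat M ((\<lambda>i. \<sigma> (e i))(n := \<sigma> a)) \<phi>)"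
    by (metis (no_types, lifting) image_iff)
  ultimately show ?case using * by simp
qed auto

lemma automorphism_holds:
  assumes "is_structure L M" "automorphism L M \<sigma>" "\<phi> \<in> formulas L (length as)" "set as \<subseteq> univ M"
  shows "holds M \<phi> (map \<sigma> as) \<longleftrightarrow> holds M \<phi> as"
proof -
  obtain c where c: "c \<in> univ M" using assms(1) unfolding is_structure_def by blast
  define e where "e i = (if i < length as then as ! i else c)" for i
  have e: "range e \<subseteq> univ M" using c assms(4) by (auto simp: e_def)
  have "holds M \<phi> (map \<sigma> as) \<longleftrightarrow> sat M (\<lambda>i. \<sigma> (e i)) \<phi>"
    using assms(3) by (intro holds_iff_sat_formula[where L=L]) (auto simp: e_def)
  also have "\<dots> \<longleftrightarrow> sat M e \<phi>"
    using automorphism_sat[OF assms(1,2) _ e] assms(3) by (simp add: formulas_def)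
  also have "\<dots> \<longleftrightarrow> holds M \<phi> as"
    using assms(3) by (intro holds_iff_sat_formula[symmetric, where L=L]) (auto simp: e_def)
  finally show ?thesis .
qed

lemma automorphism_solutions:
  assumes "is_structure L M" "automorphism L M \<sigma>" "(\<phi>, bs) \<in> pformulas L (univ M)"
  shows "solutions M (\<phi>, map \<sigma> bs) = \<sigma> ` solutions M (\<phi>, bs)"
proof -
  have "holds M \<phi> (\<sigma> a # map \<sigma> bs) \<longleftrightarrow> holds M \<phi> (a # bs)" if "a \<in> univ M" for a
    using automorphism_holds[OF assms(1,2), of \<phi> "a # bs"] that assms(3)
    by (auto simp: pformulas_def)
  then have "\<sigma> a \<in> solutions M (\<phi>, map \<sigma> bs) \<longleftrightarrow> a \<in> solutions M (\<phi>, bs)" if "a \<in> univ M" for a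
    using that automorphism_in_univ[OF assms(2)] by (simp add: solutions_def)
  moreover have "\<exists>a\<in>univ M. b = \<sigma> a" if "b \<in> univ M" for b
    using that assms(2) by (auto simp: automorphism_def bij_betw_def)
  moreover have "solutions M \<theta> \<subseteq> univ M" for \<theta> by (auto simp: solutions_def split: prod.splits)
  ultimately show ?thesis by blast
qed

section \<open>Directed unions of elementary substructures\<close>

text \<open>The Tarski-Vaught criterion for the universe of an elementary substructure of a
  structure \<open>M\<close>. Closure under the function symbols follows from it by way of their
  graph formulas, and nonemptiness by way of \<open>x = x\<close>.\<close>

definition tarski_vaught_closed :: "('f, 'r) language \<Rightarrow> ('f, 'r, 'a) fo_struct \<Rightarrow> 'a set \<Rightarrow> bool" where
  "tarski_vaught_closed L M W \<longleftrightarrow> W \<subseteq> univ M \<and>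
     (\<forall>\<theta>\<in>pformulas L W. solutions M \<theta> \<noteq> {} \<longrightarrow> solutions M \<theta> \<inter> W \<noteq> {})"

lemma tarski_vaught_closed_nonempty:
  assumes "is_structure L M" "tarski_vaught_closed L M W"
  shows "W \<noteq> {}"
proof -
  have "(Eq (Var 0) (Var 0), []) \<in> pformulas L W" by (simp add: pformulas_def formulas_def)
  moreover have "solutions M (Eq (Var 0) (Var 0), []) \<noteq> {}"
    using assms(1) by (auto simp: solutions_def holds_def is_structure_def)
  ultimately show ?thesis using assms(2) unfolding tarski_vaught_closed_def by blast
qed

lemma holds_graph:
  assumes "length bs = n"
  shows "holds M (Eq (Var 0) (Fn f (map Var [1..<Suc n]))) (b # bs) \<longleftrightarrow> b = fint M f bs"
proof -
  define e where "e = (\<lambda>i. if i < length (b # bs) then (b # bs) ! i else undefined)"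
  have "map (eval_trm M e) (map Var [1..<Suc n]) = bs"
    using assms by (intro nth_equalityI) (auto simp: e_def simp del: upt_Suc)
  moreover have "e 0 = b" by (simp add: e_def)
  ultimately show ?thesis unfolding holds_def e_def[symmetric] sat.simps eval_trm.simps by simp
qed

lemma graph_in_formulas:
  assumes "f \<in> fsyms L" "farity L f = n"
  shows "Eq (Var 0) (Fn f (map Var [1..<Suc n])) \<in> formulas L (Suc n)"
  using assms by (auto simp: formulas_def list_all_iff)

lemma holds_Rel_vars:
  assumes "length bs = n"
  shows "holds M (Rel R (map Var [0..<n])) bs \<longleftrightarrow> rint M R bs"
proof -
  define e where "e = (\<lambda>i. if i < length bs then bs ! i else undefined)"
  have "map (eval_trm M e) (map Var [0..<n]) = bs"
    using assms by (intro nth_equalityI) (auto simp: e_def)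
  then show ?thesis unfolding holds_def e_def[symmetric] sat.simps by simp
qed

lemma Rel_vars_in_formulas:
  assumes "R \<in> rsyms L" "rarity L R = n"
  shows "Rel R (map Var [0..<n]) \<in> formulas L n"
  using assms by (auto simp: formulas_def list_all_iff)

lemma sat_eq_holds:
  assumes "wf_fm L \<phi>"
  obtains m where "\<phi> \<in> formulas L m" "\<And>M e. sat M e \<phi> \<longleftrightarrow> holds M \<phi> (map e [0..<m])"
proof -
  obtain m where "\<forall>i\<in>fv \<phi>. i < m" using finite_fv[of \<phi>] finite_nat_set_iff_bounded by blast
  then have m: "\<phi> \<in> formulas L m" using assms by (auto simp: formulas_def)
  moreover have "sat M e \<phi> \<longleftrightarrow> holds M \<phi> (map e [0..<m])" for M e
    using m by (intro holds_iff_sat_formula[symmetric, where L=L]) auto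
  ultimately show thesis by (rule that)
qed

lemma sat_upd_eq_holds:
  assumes "wf_fm L \<phi>"
  obtains m \<phi>' where "\<phi>' \<in> formulas L (Suc m)"
    "\<And>M e y. sat M (e(n := y)) \<phi> \<longleftrightarrow> holds M \<phi>' (y # map e [0..<m])"
proof -
  \<comment> \<open>Solution sets are formed in variable 0, so the quantified variable
    \<open>n\<close> goes there and all others move up by one.\<close>
  define g where "g i = (if i = n then 0 else Suc i)" for i
  obtain m where "\<forall>i\<in>fv \<phi>. i < m" using finite_fv[of \<phi>] finite_nat_set_iff_bounded by blast
  then have m: "rename \<phi> g \<in> formulas L (Suc m)"
    using assms fv_rename[of \<phi> g] by (force simp: formulas_def wf_rename g_def)
  moreover have "sat M (e(n := y)) \<phi> \<longleftrightarrow> holds M (rename \<phi> g) (y # map e [0..<m])" for M e y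
  proof -
    have "holds M (rename \<phi> g) (y # map e [0..<m]) \<longleftrightarrow>
        sat M (\<lambda>i. case i of 0 \<Rightarrow> y | Suc i \<Rightarrow> e i) (rename \<phi> g)"
      using m by (intro holds_iff_sat_formula[where L=L]) (auto simp: nth_Cons split: nat.splits)
    also have "\<dots> \<longleftrightarrow> sat M (e(n := y)) \<phi>"
      unfolding sat_rename by (intro sat_cong) (auto simp: g_def)
    finally show ?thesis by simp
  qed
  ultimately show thesis by (rule that)
qed

text \<open>Each index \<open>i\<close> describes a part \<open>D i\<close> of the union by an elementary embedding \<open>v i\<close> into \<open>C\<close>.\<close>

lemma directed_union_structure:
  fixes C :: "('f, 'r, 'a) fo_struct" and D :: "'i \<Rightarrow> 'x set" and v :: "'i \<Rightarrow> 'x \<Rightarrow> 'a"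
  assumes str: "is_structure L C" and "I \<noteq> {}"
    and inj: "\<And>i. i \<in> I \<Longrightarrow> inj_on (v i) (D i)"
    and tv: "\<And>i. i \<in> I \<Longrightarrow> tarski_vaught_closed L C (v i ` D i)"
    and dir: "\<And>i j. i \<in> I \<Longrightarrow> j \<in> I \<Longrightarrow> \<exists>k\<in>I. \<forall>l\<in>{i, j}. D l \<subseteq> D k \<and>
        (\<forall>as \<phi>. set as \<subseteq> D l \<and> \<phi> \<in> formulas L (length as) \<longrightarrow>
          (holds C \<phi> (map (v l) as) \<longleftrightarrow> holds C \<phi> (map (v k) as)))"
  obtains N where "is_structure L N" "univ N = (\<Union>i\<in>I. D i)"
    "\<And>i as \<phi>. i \<in> I \<Longrightarrow> set as \<subseteq> D i \<Longrightarrow> \<phi> \<in> formulas L (length as) \<Longrightarrow>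
       holds N \<phi> as \<longleftrightarrow> holds C \<phi> (map (v i) as)"
proof -
  define G where "G = (\<Union>i\<in>I. D i)"
  \<comment> \<open>Both interpretations search through all views that contain the arguments.
    Directedness makes the choice of view immaterial, so for symbols of \<open>L\<close> the
    \<open>SOME\<close> picks a unique element.\<close>
  define N where "N = \<lparr>univ = G,
    fint = (\<lambda>f as. SOME b. \<exists>i\<in>I. set as \<subseteq> D i \<and> b \<in> D i \<and> v i b = fint C f (map (v i) as)),
    rint = (\<lambda>R as. \<exists>i\<in>I. set as \<subseteq> D i \<and> rint C R (map (v i) as))\<rparr>"
  have univ_N: "univ N = G" by (simp add: N_def)
  have nonempty: "D i \<noteq> {}" if "i \<in> I" for i
    using tarski_vaught_closed_nonempty[OF str tv[OF that]] by blast
  have v_univ: "v i b \<in> univ C" if "i \<in> I" "b \<in> D i" for i b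
    using tv[OF that(1)] that(2) by (auto simp: tarski_vaught_closed_def)
  have directed: "\<exists>k\<in>I. D i \<subseteq> D k \<and> D j \<subseteq> D k" if "i \<in> I" "j \<in> I" for i j
    using dir[OF that] by blast
  have agree: "holds C \<phi> (map (v i) as) \<longleftrightarrow> holds C \<phi> (map (v j) as)"
    if "i \<in> I" "j \<in> I" "set as \<subseteq> D i" "set as \<subseteq> D j" "\<phi> \<in> formulas L (length as)" for i j as \<phi>
    using dir[OF that(1,2)] that(3-) by (metis insertCI)
  have cover: "\<exists>i\<in>I. S \<subseteq> D i" if "finite S" "S \<subseteq> G" for S
    using that
  proof (induction S)
    case empty
    then show ?case using \<open>I \<noteq> {}\<close> by auto
  next
    case (insert x S)
    then obtain i j where "i \<in> I" "j \<in> I" "S \<subseteq> D i" "x \<in> D j" by (auto simp: G_def)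
    with directed[of i j] show ?case by blast
  qed
  have fint_N: "fint N f as \<in> D i \<and> v i (fint N f as) = fint C f (map (v i) as)"
    if i: "i \<in> I" and as: "set as \<subseteq> D i" and f: "f \<in> fsyms L" "length as = farity L f" for i f as
  proof -
    let ?P = "\<lambda>b i. i \<in> I \<and> set as \<subseteq> D i \<and> b \<in> D i \<and> v i b = fint C f (map (v i) as)"
    define \<phi> :: "('f, 'r) fm" where "\<phi> = Eq (Var 0) (Fn f (map Var [1..<Suc (length as)]))"
    have \<phi>: "\<phi> \<in> formulas L (Suc (length as))"
      unfolding \<phi>_def by (rule graph_in_formulas) (use f in auto)
    have graph: "holds C \<phi> (b # bs) \<longleftrightarrow> b = fint C f bs" if "length bs = length as" for b bs
      unfolding \<phi>_def by (rule holds_graph[OF that])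
    have "fint C f (map (v i) as) \<in> univ C"
    proof -
      have "set (map (v i) as) \<subseteq> univ C" using as v_univ[OF i] by auto
      then show ?thesis using str f by (auto simp: is_structure_def)
    qed
    then have "fint C f (map (v i) as) \<in> solutions C (\<phi>, map (v i) as)"
      using graph by (simp add: solutions_def)
    moreover have "(\<phi>, map (v i) as) \<in> pformulas L (v i ` D i)"
      using \<phi> as by (auto simp: pformulas_def)
    ultimately obtain b where b: "b \<in> D i" "holds C \<phi> (v i b # map (v i) as)"
      using tv[OF i] by (fastforce simp: tarski_vaught_closed_def solutions_def)
    then have Pb: "?P b i" using i as graph by simp
    have uniq: "b' = b" if P: "?P b' j" for b' j
    proof -
      obtain k where k: "k \<in> I" "D i \<subseteq> D k" "D j \<subseteq> D k" using directed[of i j] i P by auto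
      have "holds C \<phi> (map (v i) (b # as)) \<longleftrightarrow> holds C \<phi> (map (v k) (b # as))"
        by (rule agree) (use b i k as \<phi> in auto)
      moreover have "holds C \<phi> (map (v j) (b' # as)) \<longleftrightarrow> holds C \<phi> (map (v k) (b' # as))"
        by (rule agree) (use P k as \<phi> in auto)
      ultimately have "v k b = v k b'" using Pb P graph by simp
      moreover have "b \<in> D k" "b' \<in> D k" using k b P by auto
      ultimately show ?thesis using inj[OF k(1)] by (simp add: inj_on_eq_iff)
    qed
    have "fint N f as = b"
      unfolding N_def fo_struct.simps
      by (intro some_equality) (use Pb uniq in blast)+
    then show ?thesis using Pb by simp
  qed
  have rint_N: "rint N R as \<longleftrightarrow> rint C R (map (v i) as)"
    if i: "i \<in> I" and as: "set as \<subseteq> D i" and R: "R \<in> rsyms L" "length as = rarity L R" for i R as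
  proof -
    define \<phi> :: "('f, 'r) fm" where "\<phi> = Rel R (map Var [0..<length as])"
    have "\<phi> \<in> formulas L (length as)"
      unfolding \<phi>_def by (rule Rel_vars_in_formulas) (use R in auto)
    then have "holds C \<phi> (map (v i) as) \<longleftrightarrow> holds C \<phi> (map (v j) as)" if "j \<in> I" "set as \<subseteq> D j" for j
      using agree i as that by blast
    moreover have "holds C \<phi> (map (v j) as) \<longleftrightarrow> rint C R (map (v j) as)" for j
      unfolding \<phi>_def by (rule holds_Rel_vars) simp
    ultimately have "rint C R (map (v i) as) \<longleftrightarrow> rint C R (map (v j) as)" if "j \<in> I" "set as \<subseteq> D j" for j
      using that by blast
    moreover have "rint N R as \<longleftrightarrow> (\<exists>j\<in>I. set as \<subseteq> D j \<and> rint C R (map (v j) as))"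
      by (simp add: N_def)
    ultimately show ?thesis using i as by blast
  qed
  have structure_N: "is_structure L N"
    unfolding is_structure_def
  proof (intro conjI ballI allI impI)
    show "univ N \<noteq> {}" using \<open>I \<noteq> {}\<close> nonempty by (force simp: univ_N G_def)
    fix f as assume "f \<in> fsyms L" "length as = farity L f \<and> set as \<subseteq> univ N"
    then show "fint N f as \<in> univ N"
      using cover[of "set as"] fint_N[of _ as f] unfolding univ_N G_def by auto
  qed
  have eval_N: "eval_trm N e t \<in> D i \<and> v i (eval_trm N e t) = eval_trm C (\<lambda>k. v i (e k)) t"
    if i: "i \<in> I" and e: "range e \<subseteq> D i" and "wf_trm L t" for i e t
    using \<open>wf_trm L t\<close>
  proof (induction t)
    case (Fn f ts)
    then have *: "set (map (eval_trm N e) ts) \<subseteq> D i"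
      "map (v i) (map (eval_trm N e) ts) = map (eval_trm C (\<lambda>k. v i (e k))) ts"
      by (auto simp: list_all_iff)
    show ?case
      using fint_N[OF i *(1), of f] Fn.prems unfolding * by simp
  qed (use e in auto)
  have sat_N: "sat N e \<phi> \<longleftrightarrow> sat C (\<lambda>k. v i (e k)) \<phi>"
    if "i \<in> I" "range e \<subseteq> D i" "wf_fm L \<phi>" for i e \<phi>
    using that
  proof (induction \<phi> arbitrary: i e)
    case (Eq s t)
    then have "eval_trm N e s \<in> D i \<and> v i (eval_trm N e s) = eval_trm C (\<lambda>k. v i (e k)) s"
      "eval_trm N e t \<in> D i \<and> v i (eval_trm N e t) = eval_trm C (\<lambda>k. v i (e k)) t"
      using eval_N by auto
    then show ?case using inj[OF Eq.prems(1)] by (metis inj_on_def sat.simps(1))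
  next
    case (Rel R ts)
    then have *: "set (map (eval_trm N e) ts) \<subseteq> D i"
      "map (v i) (map (eval_trm N e) ts) = map (eval_trm C (\<lambda>k. v i (e k))) ts"
      using eval_N[OF Rel.prems(1,2)] by (auto simp: list_all_iff)
    show ?case using rint_N[OF Rel.prems(1) *(1), of R] Rel.prems(3) unfolding * by simp
  next
    case (Ex n \<phi>)
    then have wf: "wf_fm L \<phi>" by simp
    show ?case
    proof
      assume "sat N e (Ex n \<phi>)"
      then obtain b j where b: "j \<in> I" "b \<in> D j" "sat N (e(n := b)) \<phi>" by (auto simp: univ_N G_def)
      \<comment> \<open>The witness \<open>b\<close> may lie outside \<open>D i\<close>. The
        induction hypothesis is therefore used in a larger \<open>D k\<close>, and the whole
        existential formula, whose parameters lie in \<open>D i\<close>, is carried back to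
        \<open>v i\<close>.\<close>
      then obtain k where k: "k \<in> I" "D i \<subseteq> D k" "D j \<subseteq> D k" using directed Ex.prems(1) by blast
      have "range (e(n := b)) \<subseteq> D k" using b(2) k Ex.prems(2) by fastforce
      then have "sat C (\<lambda>l. v k ((e(n := b)) l)) \<phi>"
        using Ex.IH[OF k(1) _ wf] b(3) by blast
      moreover have "(\<lambda>l. v k ((e(n := b)) l)) = (\<lambda>l. v k (e l))(n := v k b)" by auto
      ultimately have "sat C ((\<lambda>l. v k (e l))(n := v k b)) \<phi>" by (simp only: simp_thms)
      moreover have "v k b \<in> univ C" using v_univ[OF k(1)] b(2) k(3) by blast
      ultimately have "sat C (\<lambda>l. v k (e l)) (Ex n \<phi>)" unfolding sat.simps by blast
      moreover obtain m where m: "Ex n \<phi> \<in> formulas L m"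
        "\<And>(M :: ('f, 'r, 'a) fo_struct) e. sat M e (Ex n \<phi>) \<longleftrightarrow> holds M (Ex n \<phi>) (map e [0..<m])"
        using sat_eq_holds[OF Ex.prems(3)] by blast
      have "holds C (Ex n \<phi>) (map (v k) (map e [0..<m])) \<longleftrightarrow>
          holds C (Ex n \<phi>) (map (v i) (map e [0..<m]))"
        by (rule agree) (use m(1) k Ex.prems in \<open>fastforce+\<close>)
      ultimately show "sat C (\<lambda>k. v i (e k)) (Ex n \<phi>)"
        by (simp only: m(2) map_map comp_def)
    next
      assume "sat C (\<lambda>k. v i (e k)) (Ex n \<phi>)"
      then obtain y where y: "y \<in> univ C" "sat C ((\<lambda>k. v i (e k))(n := y)) \<phi>" by auto
      obtain m \<phi>' where m: "\<phi>' \<in> formulas L (Suc m)"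
        "\<And>(M :: ('f, 'r, 'a) fo_struct) e y. sat M (e(n := y)) \<phi> \<longleftrightarrow> holds M \<phi>' (y # map e [0..<m])"
        using sat_upd_eq_holds[OF wf] by metis
      have "(\<phi>', map (\<lambda>k. v i (e k)) [0..<m]) \<in> pformulas L (v i ` D i)"
        using m(1) Ex.prems(2) by (auto simp: pformulas_def)
      moreover have "y \<in> solutions C (\<phi>', map (\<lambda>k. v i (e k)) [0..<m])"
        using y m(2) by (simp add: solutions_def)
      ultimately have "solutions C (\<phi>', map (\<lambda>k. v i (e k)) [0..<m]) \<inter> v i ` D i \<noteq> {}"
        using tv[OF Ex.prems(1)] unfolding tarski_vaught_closed_def by blast
      then obtain b where b: "b \<in> D i" "sat C ((\<lambda>k. v i (e k))(n := v i b)) \<phi>"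
        unfolding m(2) by (auto simp: solutions_def)
      have "(\<lambda>k. v i (e k))(n := v i b) = (\<lambda>k. v i ((e(n := b)) k))" by auto
      moreover have "range (e(n := b)) \<subseteq> D i" using b(1) Ex.prems(2) by fastforce
      ultimately have "sat N (e(n := b)) \<phi>"
        using Ex.IH[OF Ex.prems(1) _ wf, of "e(n := b)"] b(2) by (metis (no_types))
      moreover have "b \<in> univ N" using b(1) Ex.prems(1) by (auto simp: univ_N G_def)
      ultimately show "sat N e (Ex n \<phi>)" unfolding sat.simps by blast
    qed
  qed auto
  have "holds N \<phi> as \<longleftrightarrow> holds C \<phi> (map (v i) as)"
    if i: "i \<in> I" and as: "set as \<subseteq> D i" and \<phi>: "\<phi> \<in> formulas L (length as)" for i as \<phi>
  proof -
    \<comment> \<open>A default inside \<open>D i\<close>, since \<open>sat_N\<close> needs the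
      whole environment there.\<close>
    obtain d where d: "d \<in> D i" using nonempty[OF i] by blast
    define e where "e k = (if k < length as then as ! k else d)" for k
    have "holds N \<phi> as \<longleftrightarrow> sat N e \<phi>"
      using \<phi> by (intro holds_iff_sat_formula[where L=L]) (auto simp: e_def)
    also have "\<dots> \<longleftrightarrow> sat C (\<lambda>k. v i (e k)) \<phi>"
      by (rule sat_N) (use i as d \<phi> in \<open>auto simp: e_def formulas_def\<close>)
    also have "\<dots> \<longleftrightarrow> holds C \<phi> (map (v i) as)"
      using \<phi> by (intro holds_iff_sat_formula[symmetric, where L=L]) (auto simp: e_def)
    finally show ?thesis .
  qed
  then show thesis by (rule that[OF structure_N univ_N[unfolded G_def]])
qed

section \<open>Downward Loewenheim-Skolem\<close>

instance trm :: (countable) countable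
  by countable_datatype

instance fm :: (countable, countable) countable
  by countable_datatype

lemma set_trm_wf: "wf_trm L t \<Longrightarrow> set_trm t \<subseteq> fsyms L"
  by (induction t) (auto simp: list_all_iff)

lemma set_fm_wf: "wf_fm L \<phi> \<Longrightarrow> set1_fm \<phi> \<subseteq> fsyms L \<and> set2_fm \<phi> \<subseteq> rsyms L"
  using set_trm_wf by (induction \<phi>) (fastforce simp: list_all_iff)+

text \<open>The types of symbols may be uncountable. Numbering the symbols of \<open>L\<close> maps
  the well-formed formulas injectively to formulas over \<open>nat\<close>, because no other symbols
  occur in them.\<close>

lemma countable_wf_fm:
  assumes "countable_language L"
  shows "countable {\<phi>. wf_fm L \<phi>}"
proof -
  let ?h = "map_fm (to_nat_on (fsyms L)) (to_nat_on (rsyms L))"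
  have "inj_on ?h {\<phi>. wf_fm L \<phi>}"
  proof (rule inj_onI)
    fix \<phi> \<psi> assume "\<phi> \<in> {\<phi>. wf_fm L \<phi>}" "\<psi> \<in> {\<phi>. wf_fm L \<phi>}" "?h \<phi> = ?h \<psi>"
    then show "\<phi> = \<psi>"
      using set_fm_wf[of L \<phi>] set_fm_wf[of L \<psi>] assms
      by (intro fm.inj_map_strong[of \<phi> \<psi>]) (auto simp: countable_language_def subset_iff)
  qed
  then show ?thesis by (metis countable_image_inj_eq countableI_type)
qed

lemma countable_pformulas:
  assumes "countable_language L" "countable B"
  shows "countable (pformulas L B)"
proof (rule countable_subset)
  show "pformulas L B \<subseteq> {\<phi>. wf_fm L \<phi>} \<times> lists B"
    by (auto simp: pformulas_def formulas_def)
  show "countable ({\<phi>. wf_fm L \<phi>} \<times> lists B)"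
    using countable_wf_fm[OF assms(1)] assms(2) by blast
qed

lemma solutions_subset: "solutions M \<theta> \<subseteq> univ M"
  by (auto simp: solutions_def split: prod.splits)

lemma pformulas_mono: "A \<subseteq> B \<Longrightarrow> pformulas L A \<subseteq> pformulas L B"
  by (auto simp: pformulas_def)

text \<open>One chosen solution is added for each solvable formula, in countably many rounds. A
  formula over the union has finitely many parameters and so is treated at some round.\<close>

lemma countable_tarski_vaught_closed:
  assumes "countable_language L" "countable A" "A \<subseteq> univ M"
  obtains E where "countable E" "A \<subseteq> E" "tarski_vaught_closed L M E"
proof -
  define w where "w \<theta> = (SOME y. y \<in> solutions M \<theta>)" for \<theta>
  define step where "step E = E \<union> w ` {\<theta> \<in> pformulas L E. solutions M \<theta> \<noteq> {}}" for E
  define E where "E k = (step ^^ k) A" for k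
  have E_Suc: "E (Suc k) = step (E k)" for k by (simp add: E_def)
  have w: "w \<theta> \<in> solutions M \<theta>" if "solutions M \<theta> \<noteq> {}" for \<theta>
    unfolding w_def using that some_in_eq by blast
  have "countable (E k) \<and> A \<subseteq> E k \<and> E k \<subseteq> univ M" for k
  proof (induction k)
    case 0
    then show ?case using assms by (simp add: E_def)
  next
    case (Suc k)
    have "w ` {\<theta> \<in> pformulas L (E k). solutions M \<theta> \<noteq> {}} \<subseteq> univ M"
      using w solutions_subset by fastforce
    moreover have "countable {\<theta> \<in> pformulas L (E k). solutions M \<theta> \<noteq> {}}"
      by (rule countable_subset[OF _ countable_pformulas[OF assms(1), of "E k"]]) (use Suc in auto)
    ultimately show ?case using Suc by (auto simp: E_Suc step_def)
  qed note E = this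
  have mono: "E k \<subseteq> E l" if "k \<le> l" for k l
    by (rule lift_Suc_mono_le[OF _ that]) (auto simp: E_Suc step_def)
  have "tarski_vaught_closed L M (\<Union>k. E k)"
    unfolding tarski_vaught_closed_def
  proof (intro conjI ballI impI)
    show "(\<Union>k. E k) \<subseteq> univ M" using E by blast
    fix \<theta> assume \<theta>: "\<theta> \<in> pformulas L (\<Union>k. E k)" "solutions M \<theta> \<noteq> {}"
    have "\<exists>k. B \<subseteq> E k" if "finite B" "B \<subseteq> (\<Union>k. E k)" for B
      using that
    proof (induction B)
      case (insert x B)
      then obtain k l where "B \<subseteq> E k" "x \<in> E l" by auto
      then have "insert x B \<subseteq> E (max k l)" using mono[of k "max k l"] mono[of l "max k l"] by auto
      then show ?case ..
    qed auto
    then obtain k where "\<theta> \<in> pformulas L (E k)"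
      using \<theta>(1) by (auto simp: pformulas_def) (metis List.finite_set)
    then have "w \<theta> \<in> E (Suc k)" using \<theta>(2) by (auto simp: E_Suc step_def)
    then show "solutions M \<theta> \<inter> (\<Union>k. E k) \<noteq> {}" using w[OF \<theta>(2)] by blast
  qed
  moreover have "countable (\<Union>k. E k)" "A \<subseteq> (\<Union>k. E k)" using E by auto
  ultimately show thesis using that by blast
qed

lemma infinite_UNIV_fm: "infinite (UNIV :: ('f, 'r) fm set)"
proof -
  have "inj (\<lambda>n. Eq (Var n) (Var n) :: ('f, 'r) fm)" by (auto intro: injI)
  then show ?thesis using finite_imageD infinite_UNIV_nat by (metis finite_subset subset_UNIV)
qed

text \<open>Downward Loewenheim-Skolem, with the countable substructure copied onto formulas because
  the hypotheses on \<open>T\<close> speak of structures of that type.\<close>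

lemma elementary_test_struct:
  fixes C :: "('f, 'r, 'a) fo_struct"
  assumes "countable_language L" "is_structure L C" "countable A" "A \<subseteq> univ C"
  obtains N :: "('f, 'r) test_struct" and u where "is_structure L N"
    "inj_on u (univ N)" "u ` univ N \<subseteq> univ C" "A \<subseteq> u ` univ N"
    "\<And>as \<phi>. set as \<subseteq> univ N \<Longrightarrow> \<phi> \<in> formulas L (length as) \<Longrightarrow>
       holds N \<phi> as \<longleftrightarrow> holds C \<phi> (map u as)"
proof -
  obtain E where E: "countable E" "A \<subseteq> E" "tarski_vaught_closed L C E"
    using countable_tarski_vaught_closed[OF assms(1,3,4)] by blast
  obtain k :: "nat \<Rightarrow> ('f, 'r) fm" where k: "inj k"
    using infinite_UNIV_fm infinite_countable_subset by blast
  define \<iota> where "\<iota> = k \<circ> to_nat_on E"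
  define u where "u = inv_into E \<iota>"
  have \<iota>: "inj_on \<iota> E"
    unfolding \<iota>_def using k E(1) by (intro comp_inj_on) (auto intro: inj_on_subset)
  have u: "u ` (\<iota> ` E) = E" "inj_on u (\<iota> ` E)"
    unfolding u_def using \<iota> by (auto simp: inj_on_inv_into image_comp)
  \<comment> \<open>A directed system with a single member pulls the structure back along
    \<open>u\<close>.\<close>
  obtain N where "is_structure L N" "univ N = (\<Union>i\<in>{()}. \<iota> ` E)"
    "\<And>i as \<phi>. i \<in> {()} \<Longrightarrow> set as \<subseteq> \<iota> ` E \<Longrightarrow> \<phi> \<in> formulas L (length as) \<Longrightarrow>
       holds N \<phi> as \<longleftrightarrow> holds C \<phi> (map u as)"
    by (rule directed_union_structure[of L C "{()}" "\<lambda>_. u" "\<lambda>_. \<iota> ` E"])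
      (use assms(2) E(3) u in auto)
  then show thesis using that[of N u] u E by (auto simp: tarski_vaught_closed_def)
qed

text \<open>The Skolem formula is chosen before the model and hence serves all test structures at
  once. Existence, uniqueness and correctness of its value concern at most two elements besides the
  parameters, so each is checked in a countable substructure of \<open>C\<close>.\<close>

lemma definable_skolem_functions_model:
  fixes C :: "('f, 'r, 'a) fo_struct"
  assumes "countable_language L" "T \<subseteq> formulas L 0" "definable_skolem_functions L T" "model L T C"
    and "\<phi> \<in> formulas L (Suc n)"
  obtains \<psi> where "\<psi> \<in> formulas L (Suc n)"
    "\<And>bs. length bs = n \<Longrightarrow> set bs \<subseteq> univ C \<Longrightarrow> \<exists>y. solutions C (\<psi>, bs) = {y}"
    "\<And>bs. length bs = n \<Longrightarrow> set bs \<subseteq> univ C \<Longrightarrow> solutions C (\<phi>, bs) \<noteq> {} \<Longrightarrow>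
       solutions C (\<psi>, bs) \<subseteq> solutions C (\<phi>, bs)"
proof -
  obtain \<psi> where \<psi>: "\<psi> \<in> formulas L (Suc n)"
    and sk: "\<And>(M :: ('f, 'r) test_struct) xs. model L T M \<Longrightarrow> length xs = n \<Longrightarrow> set xs \<subseteq> univ M \<Longrightarrow>
      (\<exists>!y. y \<in> univ M \<and> holds M \<psi> (y # xs)) \<and>
      ((\<exists>y\<in>univ M. holds M \<phi> (y # xs)) \<longrightarrow>
        (\<forall>y\<in>univ M. holds M \<psi> (y # xs) \<longrightarrow> holds M \<phi> (y # xs)))"
    using assms(3,5) unfolding definable_skolem_functions_def by metis
  have str: "is_structure L C" using assms(4) by (simp add: model_def)
  \<comment> \<open>\<open>A\<close> collects the elements that the substructure must contain;
    \<open>S\<close> carries the value found there. Below, \<open>A\<close> is empty for existence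
    and a pair for the other two claims.\<close>
  have *: "\<exists>S. finite S \<and> solutions C (\<psi>, bs) \<inter> S \<noteq> {} \<and> card (solutions C (\<psi>, bs) \<inter> A) \<le> 1 \<and>
      (solutions C (\<phi>, bs) \<inter> A \<noteq> {} \<longrightarrow> solutions C (\<psi>, bs) \<inter> A \<subseteq> solutions C (\<phi>, bs))"
    if bs: "length bs = n" "set bs \<subseteq> univ C" and A: "finite A" "A \<subseteq> univ C" for bs A
  proof -
    obtain N :: "('f, 'r) test_struct" and u where N: "is_structure L N"
      "inj_on u (univ N)" "u ` univ N \<subseteq> univ C" "set bs \<union> A \<subseteq> u ` univ N"
      and el: "\<And>as \<phi>. set as \<subseteq> univ N \<Longrightarrow> \<phi> \<in> formulas L (length as) \<Longrightarrow>
        holds N \<phi> as \<longleftrightarrow> holds C \<phi> (map u as)"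
      using elementary_test_struct[OF assms(1) str, of "set bs \<union> A"] bs A
      by (metis Un_least countable_finite finite_UnI List.finite_set)
    have "holds N \<chi> []" if "\<chi> \<in> T" for \<chi>
    proof -
      have "holds N \<chi> [] \<longleftrightarrow> holds C \<chi> []"
        using el[of "[]" \<chi>] assms(2) that by auto
      then show ?thesis using that assms(4) by (simp add: model_def)
    qed
    then have N': "model L T N" using N(1) by (simp add: model_def)
    have "bs \<in> lists (u ` univ N)" using N(4) by auto
    then obtain cs where cs: "bs = map u cs" "set cs \<subseteq> univ N"
      by (metis imageE in_lists_conv_set lists_eq_set lists_image mem_Collect_eq)
    have cs': "length cs = n" using cs bs by simp
    have eq: "holds N \<chi> (y # cs) \<longleftrightarrow> u y \<in> solutions C (\<chi>, bs)"
      if "\<chi> \<in> formulas L (Suc n)" "y \<in> univ N" for \<chi> y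
      using el[of "y # cs" \<chi>] that N(3) cs cs' by (auto simp: solutions_def)
    obtain y where y: "y \<in> univ N" "holds N \<psi> (y # cs)"
      and uniq: "\<And>z. z \<in> univ N \<Longrightarrow> holds N \<psi> (z # cs) \<Longrightarrow> z = y"
      using sk[OF N' cs' cs(2)] by blast
    have sub: "solutions C (\<psi>, bs) \<inter> A \<subseteq> {u y}"
      using N(4) uniq eq[OF \<psi>] by fastforce
    show ?thesis
    proof (intro exI[of _ "{u y}"] conjI impI)
      show "card (solutions C (\<psi>, bs) \<inter> A) \<le> 1"
        using card_mono[OF _ sub] by simp
      show "solutions C (\<psi>, bs) \<inter> {u y} \<noteq> {}" using eq[OF \<psi> y(1)] y(2) by blast
      assume "solutions C (\<phi>, bs) \<inter> A \<noteq> {}"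
      then obtain z where "z \<in> univ N" "holds N \<phi> (z # cs)"
        using N(4) eq[OF assms(5)] by fastforce
      then have "holds N \<phi> (y # cs)" using sk[OF N' cs' cs(2)] y by blast
      then show "solutions C (\<psi>, bs) \<inter> A \<subseteq> solutions C (\<phi>, bs)"
        using sub eq[OF assms(5) y(1)] by blast
    qed simp
  qed
  show thesis
  proof (rule that[OF \<psi>])
    fix bs assume bs: "length bs = n" "set bs \<subseteq> univ C"
    have "y = z" if "y \<in> solutions C (\<psi>, bs)" "z \<in> solutions C (\<psi>, bs)" for y z
    proof (rule ccontr)
      assume "y \<noteq> z"
      moreover have "solutions C (\<psi>, bs) \<inter> {y, z} = {y, z}" using that by auto
      moreover have "{y, z} \<subseteq> univ C" using that solutions_subset by fastforce
      ultimately show False using *[OF bs, of "{y, z}"] by auto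
    qed
    moreover have "solutions C (\<psi>, bs) \<noteq> {}" using *[OF bs, of "{}"] by auto
    ultimately show "\<exists>y. solutions C (\<psi>, bs) = {y}" by blast
    assume "solutions C (\<phi>, bs) \<noteq> {}"
    then obtain z where z: "z \<in> solutions C (\<phi>, bs)" by blast
    show "solutions C (\<psi>, bs) \<subseteq> solutions C (\<phi>, bs)"
    proof
      fix y assume y: "y \<in> solutions C (\<psi>, bs)"
      have "{y, z} \<subseteq> univ C" using y z solutions_subset by fastforce
      then show "y \<in> solutions C (\<phi>, bs)" using *[OF bs, of "{y, z}"] y z by auto
    qed
  qed
qed

section \<open>Definable closure\<close>

definition dcl :: "('f, 'r) language \<Rightarrow> ('f, 'r, 'a) fo_struct \<Rightarrow> 'a set \<Rightarrow> 'a set" where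
  "dcl L M A = {y. \<exists>\<theta>\<in>pformulas L A. solutions M \<theta> = {y}}"

lemma dcl_subset: "dcl L M A \<subseteq> univ M"
  using solutions_subset by (fastforce simp: dcl_def)

text \<open>The parameter \<open>b\<close> is replaced by its definition: the new formula says that
  some \<open>z\<close> satisfies \<open>\<psi>\<close> at \<open>z # cs\<close> and
  \<open>\<phi>\<close> at \<open>a # z # bs\<close>.\<close>

lemma eliminate_parameter:
  assumes \<phi>: "\<phi> \<in> formulas L (Suc (Suc (length bs)))" and \<psi>: "\<psi> \<in> formulas L (Suc (length cs))"
    and b: "solutions M (\<psi>, cs) = {b}"
  obtains \<chi> where "\<chi> \<in> formulas L (Suc (length (bs @ cs)))"
    "solutions M (\<chi>, bs @ cs) = solutions M (\<phi>, b # bs)"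
proof -
  \<comment> \<open>\<open>N\<close> is the first index beyond the tuple \<open>a # bs @ cs\<close>
    and serves as the bound variable. \<open>g\<close> sends the slot of \<open>b\<close> there and
    closes the gap; \<open>g'\<close> sends the slot defined by \<open>\<psi>\<close> there and
    moves \<open>cs\<close> behind \<open>bs\<close>.\<close>
  define N where "N = Suc (length (bs @ cs))"
  define g where "g i = (if i = 0 then 0 else if i = 1 then N else i - 1)" for i
  define g' where "g' i = (if i = 0 then N else length bs + i)" for i
  define \<chi> where "\<chi> = Ex N (And (rename \<psi> g') (rename \<phi> g))"
  have "fv (rename \<psi> g') \<subseteq> {..N}"
    using fv_rename[of \<psi> g'] \<psi> by (force simp: formulas_def g'_def N_def)
  moreover have "fv (rename \<phi> g) \<subseteq> {..N}"
    using fv_rename[of \<phi> g] \<phi> by (force simp: formulas_def g_def N_def)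
  ultimately have \<chi>: "\<chi> \<in> formulas L N"
    using \<phi> \<psi> by (force simp: \<chi>_def formulas_def wf_rename)
  have "a \<in> solutions M (\<chi>, bs @ cs) \<longleftrightarrow> a \<in> solutions M (\<phi>, b # bs)" if a: "a \<in> univ M" for a
  proof -
    define e where "e i = (a # bs @ cs) ! i" for i
    have "holds M \<chi> (a # bs @ cs) \<longleftrightarrow> sat M e \<chi>"
      using \<chi> by (intro holds_iff_sat_formula[where L=L]) (auto simp: e_def N_def)
    moreover have "sat M (e(N := z)) (rename \<psi> g') \<longleftrightarrow> holds M \<psi> (z # cs)" for z
      unfolding sat_rename using \<psi>
      by (intro holds_iff_sat_formula[symmetric, where L=L])
        (auto simp: e_def g'_def N_def nth_Cons nth_append split: nat.splits)
    moreover have "sat M (e(N := z)) (rename \<phi> g) \<longleftrightarrow> holds M \<phi> (a # z # bs)" for z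
      unfolding sat_rename using \<phi>
      by (intro holds_iff_sat_formula[symmetric, where L=L])
        (auto simp: e_def g_def N_def nth_Cons nth_append split: nat.splits)
    ultimately have "holds M \<chi> (a # bs @ cs) \<longleftrightarrow>
        (\<exists>z\<in>univ M. holds M \<psi> (z # cs) \<and> holds M \<phi> (a # z # bs))"
      by (simp add: \<chi>_def)
    also have "\<dots> \<longleftrightarrow> (\<exists>z\<in>solutions M (\<psi>, cs). holds M \<phi> (a # z # bs))"
      by (auto simp: solutions_def)
    finally show ?thesis using a unfolding b by (simp add: solutions_def)
  qed
  then have "solutions M (\<chi>, bs @ cs) = solutions M (\<phi>, b # bs)"
    using solutions_subset[of M "(\<chi>, bs @ cs)"] solutions_subset[of M "(\<phi>, b # bs)"] by blast
  with \<chi>[unfolded N_def] show thesis by (rule that)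
qed

text \<open>Eliminating one parameter brings in new ones from \<open>A\<close>, so the induction on
  \<open>bs\<close> has to allow a growing tail \<open>as\<close>.\<close>

lemma definable_over_dcl_append:
  assumes "set bs \<subseteq> dcl L M A" "set as \<subseteq> A" "\<phi> \<in> formulas L (Suc (length (bs @ as)))"
  shows "\<exists>\<theta>\<in>pformulas L A. solutions M \<theta> = solutions M (\<phi>, bs @ as)"
  using assms
proof (induction bs arbitrary: as \<phi>)
  case Nil
  then show ?case by (force simp: pformulas_def)
next
  case (Cons b bs)
  then obtain \<psi> cs where \<psi>: "\<psi> \<in> formulas L (Suc (length cs))" "set cs \<subseteq> A"
    "solutions M (\<psi>, cs) = {b}"
    by (auto simp: dcl_def pformulas_def)
  obtain \<chi> where "\<chi> \<in> formulas L (Suc (length ((bs @ as) @ cs)))"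
    "solutions M (\<chi>, (bs @ as) @ cs) = solutions M (\<phi>, b # bs @ as)"
    using eliminate_parameter[of \<phi> L "bs @ as" \<psi> cs M b] Cons.prems(3) \<psi> by auto
  then show ?case using Cons.IH[of "as @ cs" \<chi>] Cons.prems(1,2) \<psi>(2) by auto
qed

lemma definable_over_dcl:
  assumes "\<theta> \<in> pformulas L (dcl L M A)"
  shows "\<exists>\<theta>'\<in>pformulas L A. solutions M \<theta>' = solutions M \<theta>"
  using assms definable_over_dcl_append[of _ L M A "[]"] by (auto simp: pformulas_def)

section \<open>Morley sequences of the regular type\<close>

locale regular_type =
  fixes L :: "('f, 'r) language"
    and T :: "('f, 'r) fm set"
    and \<kappa> :: "'c rel"
    and C :: "('f, 'r, 'a) fo_struct"
    and p :: "('f, 'r, 'a) pfm set"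
  assumes countable_language: "countable_language L"
    and complete_theory: "complete_theory L T"
    and skolem: "definable_skolem_functions L T"
    and monster: "monster_model L T \<kappa> C"
    and global: "global_type L C p"
    and nonalgebraic: "nonalgebraic C p"
    and regular: "strongly_regular L \<kappa> C p"
    and symmetric: "symmetric_type L C p"
begin

lemma model: "model L T C"
  using monster by (simp add: monster_model_def)

lemma is_structure: "is_structure L C"
  using model by (simp add: model_def)

text \<open>Saturation, homogeneity and regularity are all applied over finite sets; this is why the
  indiscernible set may outgrow \<open>\<kappa>\<close>.\<close>

lemma small_finite: "finite A \<Longrightarrow> small \<kappa> A"
  using monster finite_iff_ordLess_natLeq ordLess_transitive
  unfolding small_def monster_model_def by blast

text \<open>A Skolem function provides the witness: its value at parameters in the definable closure
  is definable over these, hence over \<open>A\<close>.\<close>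

lemma dcl_tarski_vaught_closed: "tarski_vaught_closed L C (dcl L C A)"
  unfolding tarski_vaught_closed_def
proof (intro conjI ballI impI)
  fix \<theta> assume \<theta>: "\<theta> \<in> pformulas L (dcl L C A)" "solutions C \<theta> \<noteq> {}"
  obtain \<phi> bs where eq: "\<theta> = (\<phi>, bs)" by force
  with \<theta> have bs: "\<phi> \<in> formulas L (Suc (length bs))" "set bs \<subseteq> dcl L C A"
    by (auto simp: pformulas_def)
  have T: "T \<subseteq> formulas L 0" using complete_theory by (simp add: complete_theory_def)
  obtain \<psi> where \<psi>: "\<psi> \<in> formulas L (Suc (length bs))"
    "\<exists>y. solutions C (\<psi>, bs) = {y}" "solutions C (\<psi>, bs) \<subseteq> solutions C (\<phi>, bs)"
    using definable_skolem_functions_model[OF countable_language T skolem model bs(1)] bs(2)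
      dcl_subset[of L C A] \<theta>(2) unfolding eq by (metis subset_trans)
  then obtain y where y: "solutions C (\<psi>, bs) = {y}" by blast
  have "(\<psi>, bs) \<in> pformulas L (dcl L C A)" using \<psi>(1) bs by (simp add: pformulas_def)
  then have "y \<in> dcl L C A" using definable_over_dcl y unfolding dcl_def by fastforce
  then show "solutions C \<theta> \<inter> dcl L C A \<noteq> {}" using y \<psi>(3) eq by auto
qed (rule dcl_subset)

lemma automorphism_of_same_type:
  assumes "length us = length us'" "set us \<subseteq> univ C" "set us' \<subseteq> univ C"
    and same: "\<And>\<phi>. \<phi> \<in> formulas L (length us) \<Longrightarrow> holds C \<phi> us \<longleftrightarrow> holds C \<phi> us'"
  obtains \<sigma> where "automorphism L C \<sigma>" "map \<sigma> us = us'"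
proof -
  define f where "f u = us' ! (SOME i. i < length us \<and> us ! i = u)" for u
  have f: "f (us ! i) = us' ! i" if i: "i < length us" for i
  proof -
    define j where "j = (SOME j. j < length us \<and> us ! j = us ! i)"
    have j: "j < length us \<and> us ! j = us ! i"
      unfolding j_def by (rule someI[of _ i]) (use i in simp)
    \<comment> \<open>\<open>us\<close> may have repetitions. The tuples agree on equality formulas,
      which makes the map from \<open>us\<close> to \<open>us'\<close> well defined.\<close>
    have "Eq (Var j) (Var i) \<in> formulas L (length us)" using i j by (simp add: formulas_def)
    from same[OF this] have "us' ! j = us' ! i" using i j assms(1) by (simp add: holds_def)
    then show ?thesis unfolding f_def j_def .
  qed
  have "partial_elementary L C (set us) f"
    unfolding partial_elementary_def
  proof (intro conjI allI impI ballI)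
    show "f ` set us \<subseteq> univ C" using f assms(1,3) by (fastforce simp: in_set_conv_nth)
    fix as \<phi> assume as: "set as \<subseteq> set us" and \<phi>: "\<phi> \<in> formulas L (length as)"
    have "\<forall>i. \<exists>j. i < length as \<longrightarrow> j < length us \<and> as ! i = us ! j"
      using as by (metis in_set_conv_nth nth_mem subsetD)
    then obtain g where g: "\<And>i. i < length as \<Longrightarrow> g i < length us \<and> as ! i = us ! g i" by metis
    have "holds C \<phi> as \<longleftrightarrow> holds C (rename \<phi> g) us"
      by (rule holds_rename[symmetric, OF \<phi>]) (use g in auto)
    also have "\<dots> \<longleftrightarrow> holds C (rename \<phi> g) us'"
      by (rule same, rule rename_in_formulas[OF \<phi>]) (use g in blast)
    also have "\<dots> \<longleftrightarrow> holds C \<phi> (map f as)"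
      using \<phi> g f assms(1) by (intro holds_rename[where L=L]) auto
    finally show "holds C \<phi> as \<longleftrightarrow> holds C \<phi> (map f as)" .
  qed
  then obtain \<sigma> where "automorphism L C \<sigma>" "\<forall>a\<in>set us. \<sigma> a = f a"
    using monster assms(2) small_finite[of "set us"]
    unfolding monster_model_def strongly_homogeneous_def by (metis List.finite_set)
  moreover from this have "map \<sigma> us = us'"
    using f assms(1) by (intro nth_equalityI) auto
  ultimately show thesis using that by blast
qed

section \<open>Realisations of the global type\<close>

lemma pformulas_of_type: "\<theta> \<in> p \<Longrightarrow> \<theta> \<in> pformulas L (univ C)"
  using global by (auto simp: global_type_def complete_type_def)

lemma type_consistent: "\<theta> \<in> p \<Longrightarrow> \<theta>' \<in> p \<Longrightarrow> solutions C \<theta> \<inter> solutions C \<theta>' \<noteq> {}"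
proof -
  assume "\<theta> \<in> p" "\<theta>' \<in> p"
  then have "\<exists>a. realises C a {\<theta>, \<theta>'}"
    using global unfolding global_type_def complete_type_def
    by (metis empty_subsetI finite.emptyI finite_insert insert_subset)
  then show ?thesis by (auto simp: realises_def)
qed

lemma type_Neg: "(\<phi>, bs) \<in> pformulas L (univ C) \<Longrightarrow> (Neg \<phi>, bs) \<in> p \<longleftrightarrow> (\<phi>, bs) \<notin> p"
  using global type_consistent[of "(\<phi>, bs)" "(Neg \<phi>, bs)"]
  unfolding global_type_def complete_type_def by (auto simp: solutions_Neg)

lemma type_invariant:
  assumes "automorphism L C \<sigma>" "(\<phi>, bs) \<in> pformulas L (univ C)"
  shows "(\<phi>, map \<sigma> bs) \<in> p \<longleftrightarrow> (\<phi>, bs) \<in> p"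
  using regular assms unfolding strongly_regular_def invariant_type_def by fast

lemma realises_mono: "realises C c (p \<restriction>\<restriction> B) \<Longrightarrow> A \<subseteq> B \<Longrightarrow> realises C c (p \<restriction>\<restriction> A)"
  unfolding realises_def restrict_type_def by blast

lemma realises_in_univ: "realises C c (p \<restriction>\<restriction> B) \<Longrightarrow> c \<in> univ C"
  by (simp add: realises_def)

lemma holds_realisation:
  assumes "realises C c (p \<restriction>\<restriction> B)" "(\<phi>, bs) \<in> pformulas L B" "B \<subseteq> univ C"
  shows "holds C \<phi> (c # bs) \<longleftrightarrow> (\<phi>, bs) \<in> p"
proof -
  have B: "set bs \<subseteq> B" and pf: "(\<phi>, bs) \<in> pformulas L (univ C)"
    using assms(2,3) by (auto simp: pformulas_def)
  have "holds C \<chi> (c # bs)" if "(\<chi>, bs) \<in> p" for \<chi>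
    using that assms(1) B by (auto simp: realises_def restrict_type_def solutions_def)
  from this[of \<phi>] this[of "Neg \<phi>"] show ?thesis using type_Neg[OF pf] by auto
qed

lemma realisation_exists:
  assumes "finite B" "B \<subseteq> univ C"
  obtains c where "realises C c (p \<restriction>\<restriction> B)"
proof -
  have "complete_type L C B (p \<restriction>\<restriction> B)"
    unfolding complete_type_def
  proof (intro conjI allI impI)
    show "p \<restriction>\<restriction> B \<subseteq> pformulas L B"
      using pformulas_of_type by (auto simp: restrict_type_def pformulas_def)
    show "\<exists>a. realises C a F" if "finite F \<and> F \<subseteq> p \<restriction>\<restriction> B" for F
      using that global unfolding global_type_def complete_type_def restrict_type_def by blast
    show "\<forall>(\<phi>, bs)\<in>pformulas L B. (\<phi>, bs) \<in> p \<restriction>\<restriction> B \<or> (Neg \<phi>, bs) \<in> p \<restriction>\<restriction> B"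
      using type_Neg pformulas_mono[OF assms(2)]
      by (fastforce simp: restrict_type_def pformulas_def)
  qed
  then show thesis
    using that monster small_finite[OF assms(1)] assms(2)
    unfolding monster_model_def saturated_def by blast
qed

text \<open>Otherwise \<open>p\<close> would contain \<open>x = c\<close>, which has a single
  solution. This is how nonalgebraicity makes the Morley sequence injective.\<close>

lemma realisation_notin:
  assumes "realises C c (p \<restriction>\<restriction> B)" "B \<subseteq> univ C"
  shows "c \<notin> B"
proof
  assume "c \<in> B"
  define \<phi> :: "('f, 'r) fm" where "\<phi> = Eq (Var 0) (Var 1)"
  have "(\<phi>, [c]) \<in> pformulas L B" using \<open>c \<in> B\<close> by (simp add: \<phi>_def pformulas_def formulas_def)
  from holds_realisation[OF assms(1) this assms(2)] have "(\<phi>, [c]) \<in> p"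
    by (simp add: \<phi>_def holds_def)
  then have "infinite (solutions C (\<phi>, [c]))" using nonalgebraic by (auto simp: nonalgebraic_def)
  moreover have "solutions C (\<phi>, [c]) \<subseteq> {c}" by (auto simp: solutions_def holds_def \<phi>_def)
  ultimately show False using finite_subset by blast
qed

section \<open>A totally indiscernible Morley sequence\<close>

definition morley_seq :: "nat \<Rightarrow> 'a" where
  "morley_seq = (SOME a. \<forall>n. realises C (a n) (p \<restriction>\<restriction> (a ` {..<n})))"

lemma realises_morley_seq_init: "realises C (morley_seq n) (p \<restriction>\<restriction> (morley_seq ` {..<n}))"
proof -
  define pick where "pick B = (SOME c. realises C c (p \<restriction>\<restriction> B))" for B
  define S where "S n = ((\<lambda>B. insert (pick B) B) ^^ n) {}" for n
  have S_Suc: "S (Suc n) = insert (pick (S n)) (S n)" for n by (simp add: S_def)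
  have pick: "realises C (pick B) (p \<restriction>\<restriction> B)" if "finite B" "B \<subseteq> univ C" for B
    unfolding pick_def using realisation_exists[OF that] by (metis someI)
  have S: "finite (S n) \<and> S n \<subseteq> univ C" for n
  proof (induction n)
    case (Suc n)
    then show ?case using realises_in_univ[OF pick[of "S n"]] by (simp add: S_Suc)
  qed (simp add: S_def)
  have "S n = (pick \<circ> S) ` {..<n}" for n
    by (induction n) (simp add: S_def, simp add: S_Suc lessThan_Suc)
  then have "\<forall>n. realises C ((pick \<circ> S) n) (p \<restriction>\<restriction> ((pick \<circ> S) ` {..<n}))"
    using pick S by (metis comp_apply)
  then have "\<forall>n. realises C (morley_seq n) (p \<restriction>\<restriction> (morley_seq ` {..<n}))"
    unfolding morley_seq_def
    by (rule someI[where P = "\<lambda>a. \<forall>n. realises C (a n) (p \<restriction>\<restriction> (a ` {..<n}))"])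
  then show ?thesis ..
qed

lemma morley_seq_in_univ: "morley_seq n \<in> univ C"
  using realises_morley_seq_init realises_in_univ by blast

lemma inj_morley_seq: "inj morley_seq"
proof (rule linorder_injI)
  fix m n :: nat assume "m < n"
  then have "morley_seq m \<in> morley_seq ` {..<n}" by simp
  moreover have "morley_seq n \<notin> morley_seq ` {..<n}"
    using morley_seq_in_univ by (intro realisation_notin[OF realises_morley_seq_init]) auto
  ultimately show "morley_seq m \<noteq> morley_seq n" by metis
qed

lemma morley_seq_indiscernible:
  assumes "distinct is" "distinct js" "length is = length js" "\<phi> \<in> formulas L (length is)"
  shows "holds C \<phi> (map morley_seq is) \<longleftrightarrow> holds C \<phi> (map morley_seq js)"
proof -
  \<comment> \<open>\<open>symmetric_type\<close> speaks of well-orders on the type of the elements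
    of \<open>C\<close>. The order of \<open>nat\<close> is therefore transported to the range of
    the sequence, which is then indexed by itself through \<open>id\<close>.\<close>
  define r where "r = dir_image natLeq morley_seq"
  have Field: "Field r = range morley_seq"
    unfolding r_def dir_image_Field by (simp add: Field_natLeq)
  have "inj_on morley_seq (Field natLeq)" using inj_morley_seq by (simp add: Field_natLeq)
  then have "Well_order r" unfolding r_def using natLeq_Well_order by (rule Well_order_dir_image[rotated])
  moreover have "realises C (id i) (p \<restriction>\<restriction> (id ` underS r i))" if "i \<in> Field r" for i
  proof -
    obtain n where n: "i = morley_seq n" using \<open>i \<in> Field r\<close> Field by auto
    have "underS r i = morley_seq ` {..<n}"
      using inj_morley_seq by (auto simp: underS_def r_def dir_image_def natLeq_def n inj_eq)
    then show ?thesis using realises_morley_seq_init n by simp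
  qed
  ultimately have "morley_sequence C p r id" unfolding morley_sequence_def by blast
  then have ti: "totally_indiscernible L C (range morley_seq) id"
    using symmetric unfolding symmetric_type_def Field[symmetric] by blast
  have "distinct (map morley_seq is)" "distinct (map morley_seq js)"
    using assms(1,2) inj_morley_seq by (auto simp: distinct_map intro: inj_on_subset)
  moreover have "set (map morley_seq is) \<subseteq> range morley_seq"
    "set (map morley_seq js) \<subseteq> range morley_seq" by auto
  moreover have "length (map morley_seq is) = length (map morley_seq js)"
    "\<phi> \<in> formulas L (length (map morley_seq is))" using assms(3,4) by auto
  ultimately have "holds C \<phi> (map id (map morley_seq is)) \<longleftrightarrow> holds C \<phi> (map id (map morley_seq js))"
    using ti unfolding totally_indiscernible_def by blast
  then show ?thesis by simp
qed

lemma automorphism_morley_seq: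
  assumes "distinct is" "distinct js" "length is = length js"
  obtains \<sigma> where "automorphism L C \<sigma>" "map \<sigma> (map morley_seq is) = map morley_seq js"
proof (rule automorphism_of_same_type[of "map morley_seq is" "map morley_seq js"])
  show "holds C \<phi> (map morley_seq is) \<longleftrightarrow> holds C \<phi> (map morley_seq js)"
    if "\<phi> \<in> formulas L (length (map morley_seq is))" for \<phi>
    using morley_seq_indiscernible[OF assms] that by simp
qed (use assms(3) morley_seq_in_univ that in auto)

text \<open>For an index \<open>N\<close> above all of \<open>I\<close> this holds by construction.
  Total indiscernibility gives an automorphism that fixes the elements indexed by \<open>I\<close>
  and moves the one at \<open>n\<close> to the one at \<open>N\<close>.\<close>

lemma realises_morley_seq:
  assumes "finite I" "n \<notin> I"
  shows "realises C (morley_seq n) (p \<restriction>\<restriction> (morley_seq ` I))"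
proof -
  obtain N where N: "\<forall>i\<in>I. i < N" using assms(1) finite_nat_set_iff_bounded by blast
  obtain ns where ns: "set ns = I" "distinct ns" using finite_distinct_list[OF assms(1)] by blast
  obtain \<sigma> where \<sigma>: "automorphism L C \<sigma>"
    "map \<sigma> (map morley_seq (n # ns)) = map morley_seq (N # ns)"
    using automorphism_morley_seq[of "n # ns" "N # ns"] ns N assms(2) by (auto simp del: list.map)
  then have fix_I: "\<sigma> (morley_seq i) = morley_seq i" if "i \<in> I" for i using that ns by auto
  have real: "realises C (morley_seq N) (p \<restriction>\<restriction> (morley_seq ` I))"
    by (rule realises_mono[OF realises_morley_seq_init]) (use N in auto)
  show ?thesis
    unfolding realises_def
  proof (intro conjI ballI)
    fix \<theta> assume \<theta>: "\<theta> \<in> p \<restriction>\<restriction> (morley_seq ` I)"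
    then obtain \<phi> bs where eq: "\<theta> = (\<phi>, bs)" "set bs \<subseteq> morley_seq ` I"
      by (auto simp: restrict_type_def)
    have "\<theta> \<in> pformulas L (univ C)" using \<theta> pformulas_of_type by (auto simp: restrict_type_def)
    then have \<phi>: "\<phi> \<in> formulas L (length (morley_seq n # bs))" "set bs \<subseteq> univ C"
      by (auto simp: eq pformulas_def)
    have "map \<sigma> bs = bs" using eq(2) fix_I by (intro map_idI) auto
    moreover have "holds C \<phi> (morley_seq N # bs)"
      using real \<theta> by (auto simp: realises_def eq solutions_def)
    ultimately have "holds C \<phi> (map \<sigma> (morley_seq n # bs))" using \<sigma>(2) by simp
    then show "morley_seq n \<in> solutions C \<theta>"
      using automorphism_holds[OF is_structure \<sigma>(1) \<phi>(1)] \<phi>(2) morley_seq_in_univ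
      by (simp add: eq solutions_def)
  qed (rule morley_seq_in_univ)
qed

text \<open>Finite Morley sequences over \<open>A\<close>, latest element first: list induction then
  removes the element in variable 0, whose type over the others is prescribed by
  \<open>p\<close>.\<close>

primrec morley_list :: "'a set \<Rightarrow> 'a list \<Rightarrow> bool" where
  "morley_list A [] \<longleftrightarrow> True"
| "morley_list A (x # xs) \<longleftrightarrow> realises C x (p \<restriction>\<restriction> (A \<union> set xs)) \<and> morley_list A xs"

lemma morley_list_in_univ: "morley_list A xs \<Longrightarrow> set xs \<subseteq> univ C"
  by (induction xs) (auto simp: realises_def)

lemma morley_list_morley_seq:
  assumes "finite I" "distinct ns" "set ns \<inter> I = {}"
  shows "morley_list (morley_seq ` I) (map morley_seq ns)"
  using assms(2,3)
proof (induction ns)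
  case (Cons i ns)
  then show ?case
    using realises_morley_seq[of "I \<union> set ns" i] assms(1) by (simp add: image_Un)
qed simp

text \<open>By induction an automorphism carries one tail to the other and fixes \<open>as\<close>.
  Invariance of \<open>p\<close> then shows that the two heads satisfy corresponding formulas over
  the two tails.\<close>

lemma morley_list_same_type:
  assumes "morley_list A xs" "morley_list A xs'" "length xs = length xs'"
    and "set as \<subseteq> A" "A \<subseteq> univ C" "\<phi> \<in> formulas L (length (xs @ as))"
  shows "holds C \<phi> (xs @ as) \<longleftrightarrow> holds C \<phi> (xs' @ as)"
  using assms
proof (induction xs arbitrary: xs' \<phi>)
  case Nil
  then show ?case by simp
next
  case (Cons x zs)
  then obtain x' zs' where xs': "xs' = x' # zs'" by (cases xs') auto
  have univ: "set (zs @ as) \<subseteq> univ C" "set (zs' @ as) \<subseteq> univ C"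
    using Cons.prems xs' morley_list_in_univ[of A zs] morley_list_in_univ[of A zs'] by auto
  have len: "length zs = length zs'" using Cons.prems xs' by simp
  have "holds C \<psi> (zs @ as) \<longleftrightarrow> holds C \<psi> (zs' @ as)" if "\<psi> \<in> formulas L (length (zs @ as))" for \<psi>
    by (rule Cons.IH) (use Cons.prems xs' that in auto)
  then obtain \<sigma> where \<sigma>: "automorphism L C \<sigma>" "map \<sigma> (zs @ as) = zs' @ as"
    using automorphism_of_same_type[of "zs @ as" "zs' @ as"] univ len by auto
  have \<phi>: "\<phi> \<in> formulas L (Suc (length (zs @ as)))" using Cons.prems by simp
  have "holds C \<phi> (x # zs @ as) \<longleftrightarrow> (\<phi>, zs @ as) \<in> p"
    by (rule holds_realisation[of x "A \<union> set zs"])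
      (use Cons.prems univ \<phi> in \<open>auto simp: pformulas_def\<close>)
  also have "\<dots> \<longleftrightarrow> (\<phi>, map \<sigma> (zs @ as)) \<in> p"
    by (rule type_invariant[symmetric, OF \<sigma>(1)]) (use univ \<phi> in \<open>auto simp: pformulas_def\<close>)
  also have "\<dots> \<longleftrightarrow> (\<phi>, zs' @ as) \<in> p" unfolding \<sigma>(2) ..
  also have "\<dots> \<longleftrightarrow> holds C \<phi> (x' # zs' @ as)"
    by (rule holds_realisation[symmetric, of x' "A \<union> set zs'"])
      (use Cons.prems univ \<phi> xs' len in \<open>auto simp: pformulas_def\<close>)
  finally show ?case by (simp add: xs')
qed

text \<open>Regularity makes an element outside the locus of \<open>p\<close> over \<open>A\<close> invisible to the elements that
  realise \<open>p\<close> over \<open>A\<close>.\<close>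

lemma morley_list_insert:
  assumes "finite A" "A \<subseteq> univ C" "y \<in> univ C" "\<not> realises C y (p \<restriction>\<restriction> A)" "morley_list A xs"
  shows "morley_list (insert y A) xs"
  using assms(5)
proof (induction xs)
  case (Cons x xs)
  let ?B = "A \<union> set xs"
  have "?B \<subseteq> univ C" "small \<kappa> ?B"
    using assms(1,2) morley_list_in_univ[of A xs] Cons.prems by (auto intro!: small_finite)
  then have "realises C y (p \<restriction>\<restriction> ?B) \<or> implies_type C (p \<restriction>\<restriction> ?B) (p \<restriction>\<restriction> (?B \<union> {y}))"
    using regular assms(3) unfolding strongly_regular_def by blast
  moreover have "\<not> realises C y (p \<restriction>\<restriction> ?B)" using assms(4) realises_mono[of y ?B A] by blast
  ultimately have "realises C x (p \<restriction>\<restriction> (?B \<union> {y}))"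
    using Cons.prems by (simp add: implies_type_def)
  then show ?case using Cons by simp
qed simp

lemma automorphism_morley_list:
  assumes "finite A" "A \<subseteq> univ C" "morley_list A xs" "morley_list A xs'" "length xs = length xs'"
  obtains \<sigma> where "automorphism L C \<sigma>" "\<And>b. b \<in> A \<Longrightarrow> \<sigma> b = b" "map \<sigma> xs = xs'"
proof -
  obtain as where as: "set as = A" using finite_list[OF assms(1)] by blast
  obtain \<sigma> where "automorphism L C \<sigma>" "map \<sigma> (xs @ as) = xs' @ as"
  proof (rule automorphism_of_same_type[of "xs @ as" "xs' @ as"])
    show "holds C \<phi> (xs @ as) \<longleftrightarrow> holds C \<phi> (xs' @ as)" if "\<phi> \<in> formulas L (length (xs @ as))" for \<phi>
      using morley_list_same_type[OF assms(3,4,5)] as assms(2) that by blast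
  qed (use assms as morley_list_in_univ[OF assms(3)] morley_list_in_univ[OF assms(4)] that in auto)
  moreover from this(2) have "map \<sigma> xs = xs'" "map \<sigma> as = as" using assms(5) by auto
  ultimately show thesis using that as by (metis map_eq_conv map_ident)
qed

end

section \<open>The Skolem hull of an indiscernible set\<close>

lemma finite_inj_nat:
  assumes "finite S"
  obtains h :: "'x \<Rightarrow> nat" where "inj_on h S"
  using countable_finite[OF assms] unfolding countable_def by blast

context regular_type
begin

definition inst :: "('x \<Rightarrow> nat) \<Rightarrow> ('f, 'r, 'x) pfm \<Rightarrow> ('f, 'r, 'a) pfm" where
  "inst h \<theta> = (fst \<theta>, map (\<lambda>x. morley_seq (h x)) (snd \<theta>))"

abbreviation params :: "('f, 'r, 'x) pfm \<Rightarrow> 'x set" where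
  "params \<theta> \<equiv> set (snd \<theta>)"

definition denotation :: "('x \<Rightarrow> nat) \<Rightarrow> ('f, 'r, 'x) pfm \<Rightarrow> 'a" where
  "denotation h \<theta> = the_elem (solutions C (inst h \<theta>))"

text \<open>A code denotes an element of the hull of an indiscernible set indexed by \<open>'x\<close>; it is
  evaluated in \<open>C\<close> after sending its parameters into the Morley sequence injectively.\<close>

definition code :: "('f, 'r, 'x) pfm \<Rightarrow> bool" where
  "code \<theta> \<longleftrightarrow> \<theta> \<in> pformulas L UNIV \<and>
     (\<exists>h. inj_on h (params \<theta>) \<and> (\<exists>y. solutions C (inst h \<theta>) = {y}))"

definition same_denotation :: "('f, 'r, 'x) pfm \<Rightarrow> ('f, 'r, 'x) pfm \<Rightarrow> bool" where
  "same_denotation \<theta> \<theta>' \<longleftrightarrow>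
     (\<forall>h. inj_on h (params \<theta> \<union> params \<theta>') \<longrightarrow> denotation h \<theta> = denotation h \<theta>')"

lemma inst_in_pformulas: "\<theta> \<in> pformulas L S \<Longrightarrow> inst h \<theta> \<in> pformulas L (morley_seq ` h ` S)"
  by (auto simp: inst_def pformulas_def)

lemma inst_in_pformulas_univ: "\<theta> \<in> pformulas L UNIV \<Longrightarrow> inst h \<theta> \<in> pformulas L (univ C)"
  using inst_in_pformulas[of \<theta> UNIV h] morley_seq_in_univ by (fastforce simp: pformulas_def)

text \<open>Total indiscernibility in the form used for codes: any two injections of a finite
  parameter set are conjugate.\<close>

lemma automorphism_reindex:
  assumes "finite S" "inj_on h S" "inj_on h' S"
  obtains \<sigma> where "automorphism L C \<sigma>" "\<And>x. x \<in> S \<Longrightarrow> \<sigma> (morley_seq (h x)) = morley_seq (h' x)"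
proof -
  obtain xs where xs: "set xs = S" "distinct xs" using finite_distinct_list[OF assms(1)] by blast
  obtain \<sigma> where "automorphism L C \<sigma>"
    "map \<sigma> (map morley_seq (map h xs)) = map morley_seq (map h' xs)"
    by (rule automorphism_morley_seq[of "map h xs" "map h' xs"])
      (use xs assms in \<open>auto simp: distinct_map\<close>)
  then show thesis using that[of \<sigma>] xs by auto
qed

lemma solutions_inst_automorphism:
  assumes "automorphism L C \<sigma>" "\<And>x. x \<in> params \<theta> \<Longrightarrow> \<sigma> (morley_seq (h x)) = morley_seq (h' x)"
    and "\<theta> \<in> pformulas L UNIV"
  shows "solutions C (inst h' \<theta>) = \<sigma> ` solutions C (inst h \<theta>)"
proof -
  have "map (\<lambda>x. morley_seq (h' x)) (snd \<theta>) = map \<sigma> (map (\<lambda>x. morley_seq (h x)) (snd \<theta>))"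
    using assms(2) by simp
  then show ?thesis
    using automorphism_solutions[OF is_structure assms(1)] inst_in_pformulas_univ[OF assms(3), of h]
    unfolding inst_def by metis
qed

lemma inst_in_type_iff:
  assumes "\<theta> \<in> pformulas L UNIV" "inj_on h (params \<theta>)" "inj_on h' (params \<theta>)"
  shows "inst h' \<theta> \<in> p \<longleftrightarrow> inst h \<theta> \<in> p"
proof -
  obtain \<sigma> where \<sigma>: "automorphism L C \<sigma>"
    "\<And>x. x \<in> params \<theta> \<Longrightarrow> \<sigma> (morley_seq (h x)) = morley_seq (h' x)"
    using automorphism_reindex[OF _ assms(2,3)] by (metis List.finite_set)
  then have "map (\<lambda>x. morley_seq (h' x)) (snd \<theta>) = map \<sigma> (map (\<lambda>x. morley_seq (h x)) (snd \<theta>))"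
    by simp
  then show ?thesis
    using type_invariant[OF \<sigma>(1)] inst_in_pformulas_univ[OF assms(1), of h]
    unfolding inst_def by metis
qed

text \<open>\<open>code\<close> demands uniqueness under one injection; automorphisms spread it to
  all of them.\<close>

lemma solutions_code:
  assumes "code \<theta>" "inj_on h (params \<theta>)"
  shows "solutions C (inst h \<theta>) = {denotation h \<theta>}"
proof -
  obtain h' y where h': "inj_on h' (params \<theta>)" "solutions C (inst h' \<theta>) = {y}"
    using assms(1) by (auto simp: code_def)
  obtain \<sigma> where "automorphism L C \<sigma>"
    "\<And>x. x \<in> params \<theta> \<Longrightarrow> \<sigma> (morley_seq (h' x)) = morley_seq (h x)"
    using automorphism_reindex[OF _ h'(1) assms(2)] by (metis List.finite_set)
  then have "solutions C (inst h \<theta>) = \<sigma> ` solutions C (inst h' \<theta>)"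
    using assms(1) by (intro solutions_inst_automorphism) (auto simp: code_def)
  then show ?thesis using h'(2) by (simp add: denotation_def)
qed

lemma denotation_in_univ: "code \<theta> \<Longrightarrow> inj_on h (params \<theta>) \<Longrightarrow> denotation h \<theta> \<in> univ C"
  using solutions_code[of \<theta> h] solutions_subset[of C "inst h \<theta>"] by auto

lemma denotation_automorphism:
  assumes "automorphism L C \<sigma>" "\<And>x. x \<in> S \<Longrightarrow> \<sigma> (morley_seq (h x)) = morley_seq (h' x)"
    and "code \<theta>" "inj_on h S" "params \<theta> \<subseteq> S"
  shows "denotation h' \<theta> = \<sigma> (denotation h \<theta>)"
proof -
  have "solutions C (inst h' \<theta>) = \<sigma> ` solutions C (inst h \<theta>)"
    by (rule solutions_inst_automorphism[OF assms(1)])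
      (use assms(2,5) in blast, use assms(3) in \<open>simp add: code_def\<close>)
  also have "\<dots> = {\<sigma> (denotation h \<theta>)}"
    unfolding solutions_code[OF assms(3) inj_on_subset[OF assms(4,5)]] by simp
  finally show ?thesis by (simp add: denotation_def[of h'])
qed

text \<open>An automorphism carries the values at \<open>h\<close> to those at any other injection,
  so a single evaluation, even on a larger set \<open>S\<close>, decides the relation.\<close>

lemma same_denotation_iff:
  fixes h :: "'x \<Rightarrow> nat"
  assumes "finite S" "inj_on h S" "code \<theta>" "code \<theta>'" "params \<theta> \<subseteq> S" "params \<theta>' \<subseteq> S"
  shows "same_denotation \<theta> \<theta>' \<longleftrightarrow> denotation h \<theta> = denotation h \<theta>'"
proof -
  have h: "inj_on h (params \<theta> \<union> params \<theta>')"
    using assms(5,6) by (intro inj_on_subset[OF assms(2)]) auto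
  show ?thesis
  proof
    assume "same_denotation \<theta> \<theta>'"
    then show "denotation h \<theta> = denotation h \<theta>'"
      using h unfolding same_denotation_def by blast
  next
    assume eq: "denotation h \<theta> = denotation h \<theta>'"
    show "same_denotation \<theta> \<theta>'"
      unfolding same_denotation_def
    proof (intro allI impI)
      fix h' :: "'x \<Rightarrow> nat" assume h': "inj_on h' (params \<theta> \<union> params \<theta>')"
      obtain \<sigma> where \<sigma>: "automorphism L C \<sigma>"
        "\<And>x. x \<in> params \<theta> \<union> params \<theta>' \<Longrightarrow> \<sigma> (morley_seq (h x)) = morley_seq (h' x)"
        using automorphism_reindex[OF _ h h'] by (metis List.finite_set finite_UnI)
      show "denotation h' \<theta> = denotation h' \<theta>'"
        using denotation_automorphism[OF \<sigma> assms(3) h] denotation_automorphism[OF \<sigma> assms(4) h] eq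
        by simp
    qed
  qed
qed

lemma same_denotation_refl: "same_denotation \<theta> \<theta>"
  by (simp add: same_denotation_def)

lemma same_denotation_sym: "same_denotation \<theta> \<theta>' \<Longrightarrow> same_denotation \<theta>' \<theta>"
  by (simp add: same_denotation_def Un_commute)

text \<open>An injection on the parameters of the outer codes need not be injective on those of
  \<open>\<theta>2\<close>. The relation is therefore tested at one injection of all three parameter
  sets.\<close>

lemma same_denotation_trans:
  assumes "code \<theta>1" "code \<theta>2" "code \<theta>3" "same_denotation \<theta>1 \<theta>2" "same_denotation \<theta>2 \<theta>3"
  shows "same_denotation \<theta>1 \<theta>3"
proof -
  let ?S = "params \<theta>1 \<union> params \<theta>2 \<union> params \<theta>3"
  have fin: "finite ?S" by simp
  obtain h :: "_ \<Rightarrow> nat" where h: "inj_on h ?S" by (rule finite_inj_nat[OF fin])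
  show ?thesis
    using same_denotation_iff[OF fin h assms(1,2)] same_denotation_iff[OF fin h assms(2,3)]
      same_denotation_iff[OF fin h assms(1,3)] assms(4,5)
    by auto
qed

end

text \<open>\<open>enc\<close> stores codes in the index type, so that a class of codes is
  represented by an element of \<open>'x\<close> and the model has elements of this type.\<close>

locale skolem_hull = regular_type L T \<kappa> C p
  for L :: "('f, 'r) language" and T and \<kappa> :: "'c rel" and C :: "('f, 'r, 'a) fo_struct" and p +
  fixes enc :: "('f, 'r, 'x) pfm \<Rightarrow> 'x"
  assumes inj_enc: "inj_on enc (pformulas L UNIV)"
    and uncountable_index: "uncountable (UNIV :: 'x set)"
begin

definition elt :: "('f, 'r, 'x) pfm \<Rightarrow> 'x" where
  "elt \<theta> = enc (SOME \<theta>'. code \<theta>' \<and> same_denotation \<theta> \<theta>')"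

lemma elt_eq_iff:
  assumes "code \<theta>" "code \<theta>'"
  shows "elt \<theta> = elt \<theta>' \<longleftrightarrow> same_denotation \<theta> \<theta>'"
proof
  assume "same_denotation \<theta> \<theta>'"
  then have "(code \<chi> \<and> same_denotation \<theta> \<chi>) = (code \<chi> \<and> same_denotation \<theta>' \<chi>)" for \<chi>
    using assms same_denotation_trans same_denotation_sym by metis
  then show "elt \<theta> = elt \<theta>'" by (simp add: elt_def)
next
  define r where "r \<theta> = (SOME \<theta>'. code \<theta>' \<and> same_denotation \<theta> \<theta>')"
    for \<theta> :: "('f, 'r, 'x) pfm"
  have r: "code (r \<theta>) \<and> same_denotation \<theta> (r \<theta>)" if "code \<theta>" for \<theta>
    unfolding r_def by (rule someI[of _ \<theta>]) (use that same_denotation_refl in blast)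
  assume "elt \<theta> = elt \<theta>'"
  then have "enc (r \<theta>) = enc (r \<theta>')" by (simp add: elt_def r_def)
  then have "r \<theta> = r \<theta>'"
    using inj_onD[OF inj_enc] r[OF assms(1)] r[OF assms(2)] by (simp add: code_def)
  then show "same_denotation \<theta> \<theta>'"
    using r assms same_denotation_trans same_denotation_sym by metis
qed

definition hull :: "'x set \<Rightarrow> 'x set" where
  "hull S = elt ` {\<theta>. code \<theta> \<and> params \<theta> \<subseteq> S}"

text \<open>The representative stored in \<open>g\<close> may use parameters outside
  \<open>S\<close>, where \<open>h\<close> is not controlled. Hence a code of \<open>g\<close> with
  parameters in \<open>S\<close> is evaluated; \<open>view_elt\<close> shows that its choice does
  not matter.\<close>

definition view :: "'x set \<times> ('x \<Rightarrow> nat) \<Rightarrow> 'x \<Rightarrow> 'a" where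
  "view = (\<lambda>(S, h) g. denotation h (SOME \<theta>. code \<theta> \<and> params \<theta> \<subseteq> S \<and> elt \<theta> = g))"

lemma view_elt:
  assumes "finite S" "inj_on h S" "code \<theta>" "params \<theta> \<subseteq> S"
  shows "view (S, h) (elt \<theta>) = denotation h \<theta>"
proof -
  define \<theta>' where "\<theta>' = (SOME \<theta>'. code \<theta>' \<and> params \<theta>' \<subseteq> S \<and> elt \<theta>' = elt \<theta>)"
  have "code \<theta>' \<and> params \<theta>' \<subseteq> S \<and> elt \<theta>' = elt \<theta>"
    unfolding \<theta>'_def by (rule someI[of _ \<theta>]) (use assms in blast)
  then have "denotation h \<theta>' = denotation h \<theta>"
    using elt_eq_iff[of \<theta>' \<theta>] same_denotation_iff[OF assms(1,2), of \<theta>' \<theta>] assms(3,4) by simp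
  then show ?thesis by (simp add: view_def \<theta>'_def)
qed

lemma inj_on_view:
  assumes "finite S" "inj_on h S"
  shows "inj_on (view (S, h)) (hull S)"
proof (rule inj_onI)
  fix g g' assume "g \<in> hull S" "g' \<in> hull S" and eq: "view (S, h) g = view (S, h) g'"
  then obtain \<theta> \<theta>' where "g = elt \<theta>" "code \<theta>" "params \<theta> \<subseteq> S" "g' = elt \<theta>'" "code \<theta>'" "params \<theta>' \<subseteq> S"
    by (auto simp: hull_def)
  then show "g = g'" using eq view_elt[OF assms] elt_eq_iff same_denotation_iff[OF assms] by metis
qed

text \<open>A definition over the image of \<open>S\<close> is an instance of a code over
  \<open>S\<close>, since its parameters can be pulled back. Thus each finitely generated part is
  seen as a definable closure and satisfies the Tarski-Vaught criterion.\<close>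

lemma view_hull:
  assumes "finite S" "inj_on h S"
  shows "view (S, h) ` hull S = dcl L C (morley_seq ` h ` S)"
proof (intro equalityI subsetI)
  fix y assume "y \<in> view (S, h) ` hull S"
  then obtain \<theta> where \<theta>: "code \<theta>" "params \<theta> \<subseteq> S" "y = denotation h \<theta>"
    using view_elt[OF assms] by (auto simp: hull_def)
  then have "inst h \<theta> \<in> pformulas L (morley_seq ` h ` S)"
    using inst_in_pformulas[of \<theta> S h] by (auto simp: code_def pformulas_def)
  then show "y \<in> dcl L C (morley_seq ` h ` S)"
    using solutions_code[OF \<theta>(1)] inj_on_subset[OF assms(2)] \<theta> unfolding dcl_def by blast
next
  fix y assume "y \<in> dcl L C (morley_seq ` h ` S)"
  then obtain \<psi> bs where \<psi>: "(\<psi>, bs) \<in> pformulas L (morley_seq ` h ` S)" "solutions C (\<psi>, bs) = {y}"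
    by (auto simp: dcl_def)
  then have "bs \<in> lists ((\<lambda>x. morley_seq (h x)) ` S)" by (auto simp: pformulas_def)
  then obtain xs where xs: "set xs \<subseteq> S" "bs = map (\<lambda>x. morley_seq (h x)) xs"
    unfolding lists_image by auto
  then have inst: "inst h (\<psi>, xs) = (\<psi>, bs)" by (simp add: inst_def)
  have "code (\<psi>, xs)"
    unfolding code_def
  proof (intro conjI exI)
    show "(\<psi>, xs) \<in> pformulas L UNIV" using \<psi>(1) xs(2) by (auto simp: pformulas_def)
    show "inj_on h (params (\<psi>, xs))" using xs(1) assms(2) by (auto intro: inj_on_subset)
    show "solutions C (inst h (\<psi>, xs)) = {y}" using \<psi>(2) inst by simp
  qed
  moreover have "denotation h (\<psi>, xs) = y" using \<psi>(2) inst by (simp add: denotation_def)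
  ultimately show "y \<in> view (S, h) ` hull S"
    using view_elt[OF assms, of "(\<psi>, xs)"] xs(1) by (force simp: hull_def)
qed

lemma hull_mono: "S \<subseteq> S' \<Longrightarrow> hull S \<subseteq> hull S'"
  by (auto simp: hull_def)

lemma view_automorphism:
  assumes "finite S'" "S \<subseteq> S'" "inj_on h S" "inj_on h' S'"
  obtains \<sigma> where "automorphism L C \<sigma>" "\<And>x. x \<in> S \<Longrightarrow> \<sigma> (morley_seq (h x)) = morley_seq (h' x)"
    "\<And>g. g \<in> hull S \<Longrightarrow> view (S', h') g = \<sigma> (view (S, h) g)"
proof -
  have S: "finite S" "inj_on h' S" using assms finite_subset inj_on_subset by auto
  obtain \<sigma> where \<sigma>: "automorphism L C \<sigma>"
    "\<And>x. x \<in> S \<Longrightarrow> \<sigma> (morley_seq (h x)) = morley_seq (h' x)"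
    using automorphism_reindex[OF S(1) assms(3) S(2)] by blast
  have "view (S', h') g = \<sigma> (view (S, h) g)" if "g \<in> hull S" for g
  proof -
    obtain \<theta> where "g = elt \<theta>" "code \<theta>" "params \<theta> \<subseteq> S" using \<open>g \<in> hull S\<close> by (auto simp: hull_def)
    then show ?thesis
      using view_elt[OF S(1) assms(3)] view_elt[OF assms(1,4)] assms(2)
        denotation_automorphism[OF \<sigma> _ assms(3)] by auto
  qed
  with \<sigma> show thesis by (rule that)
qed

lemma view_in_univ:
  assumes "finite S" "inj_on h S" "g \<in> hull S"
  shows "view (S, h) g \<in> univ C"
  using view_hull[OF assms(1,2)] assms(3) dcl_subset[of L C] by blast

section \<open>The structure on the hull\<close>

lemma hull_structure:
  obtains N where "is_structure L N" "univ N = hull UNIV"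
    "\<And>S h as \<phi>. finite S \<Longrightarrow> inj_on h S \<Longrightarrow> set as \<subseteq> hull S \<Longrightarrow> \<phi> \<in> formulas L (length as) \<Longrightarrow>
       holds N \<phi> as \<longleftrightarrow> holds C \<phi> (map (view (S, h)) as)"
proof -
  define I :: "('x set \<times> ('x \<Rightarrow> nat)) set" where "I = {(S, h). finite S \<and> inj_on h S}"
  define D where "D i = hull (fst i)" for i :: "'x set \<times> ('x \<Rightarrow> nat)"
  have ne: "I \<noteq> {}" by (auto simp: I_def)
  have inj: "inj_on (view i) (D i)" if "i \<in> I" for i
    using that inj_on_view by (auto simp: I_def D_def)
  have tv: "tarski_vaught_closed L C (view i ` D i)" if "i \<in> I" for i
    using that view_hull dcl_tarski_vaught_closed by (auto simp: I_def D_def)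
  have dir: "\<exists>k\<in>I. \<forall>l\<in>{i, j}. D l \<subseteq> D k \<and>
      (\<forall>as \<phi>. set as \<subseteq> D l \<and> \<phi> \<in> formulas L (length as) \<longrightarrow>
        (holds C \<phi> (map (view l) as) \<longleftrightarrow> holds C \<phi> (map (view k) as)))"
    if ij: "i \<in> I" "j \<in> I" for i j
  proof -
    \<comment> \<open>The injections of \<open>i\<close> and \<open>j\<close> need not have a common
      injective extension. A fresh injection on the union is chosen, and the views are compared
      through automorphisms of \<open>C\<close>.\<close>
    define U where "U = fst i \<union> fst j"
    have U: "finite U" using ij by (auto simp: U_def I_def)
    then obtain h :: "_ \<Rightarrow> nat" where h: "inj_on h U" by (rule finite_inj_nat)
    have "D l \<subseteq> D (U, h) \<and> (\<forall>as \<phi>. set as \<subseteq> D l \<and> \<phi> \<in> formulas L (length as) \<longrightarrow>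
        (holds C \<phi> (map (view l) as) \<longleftrightarrow> holds C \<phi> (map (view (U, h)) as)))" if "l \<in> {i, j}" for l
    proof -
      obtain S k where l: "l = (S, k)" by force
      have S: "finite S" "inj_on k S" "S \<subseteq> U" using that ij l by (auto simp: I_def U_def)
      obtain \<sigma> where \<sigma>: "automorphism L C \<sigma>" "\<And>g. g \<in> hull S \<Longrightarrow> view (U, h) g = \<sigma> (view (S, k) g)"
        using view_automorphism[OF U S(3,2) h] by metis
      have "holds C \<phi> (map (view l) as) \<longleftrightarrow> holds C \<phi> (map (view (U, h)) as)"
        if "set as \<subseteq> D l" "\<phi> \<in> formulas L (length as)" for as \<phi>
      proof -
        have eq: "map (view (U, h)) as = map \<sigma> (map (view l) as)"
          using \<sigma>(2) that(1) by (auto simp: l D_def)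
        have "set (map (view l) as) \<subseteq> univ C"
          using view_in_univ[OF S(1,2)] that(1) by (auto simp: l D_def)
        then show ?thesis
          unfolding eq using automorphism_holds[OF is_structure \<sigma>(1), of \<phi> "map (view l) as"] that(2)
          by simp
      qed
      then show ?thesis using hull_mono[OF S(3)] by (simp add: l D_def)
    qed
    moreover have "(U, h) \<in> I" using U h by (simp add: I_def)
    ultimately show ?thesis by blast
  qed
  obtain N where N: "is_structure L N" "univ N = (\<Union>i\<in>I. D i)"
    "\<And>i as \<phi>. i \<in> I \<Longrightarrow> set as \<subseteq> D i \<Longrightarrow> \<phi> \<in> formulas L (length as) \<Longrightarrow>
       holds N \<phi> as \<longleftrightarrow> holds C \<phi> (map (view i) as)"
    by (rule directed_union_structure[OF is_structure ne inj tv dir]; (assumption | (rule that; blast)))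
  have "hull UNIV \<subseteq> (\<Union>i\<in>I. D i)"
  proof
    fix g assume "g \<in> hull UNIV"
    then obtain \<theta> where \<theta>: "code \<theta>" "g = elt \<theta>" by (auto simp: hull_def)
    obtain h :: "_ \<Rightarrow> nat" where "inj_on h (params \<theta>)" by (rule finite_inj_nat[OF List.finite_set])
    then have "(params \<theta>, h) \<in> I" by (simp add: I_def)
    moreover have "g \<in> D (params \<theta>, h)" using \<theta> by (auto simp: D_def hull_def)
    ultimately show "g \<in> (\<Union>i\<in>I. D i)" by blast
  qed
  moreover have "D i \<subseteq> hull UNIV" for i by (simp add: D_def hull_mono)
  ultimately have univ_N: "univ N = hull UNIV" using N(2) by blast
  show thesis
    by (rule that[OF N(1) univ_N]) (use N(3) in \<open>auto simp: I_def D_def\<close>)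
qed

lemma hull_of_elements:
  assumes "finite B" "B \<subseteq> hull UNIV"
  obtains S where "finite S" "B \<subseteq> hull S"
proof -
  have "\<forall>b\<in>B. \<exists>\<theta>. code \<theta> \<and> b = elt \<theta>"
    using assms(2) unfolding hull_def by blast
  then obtain c where c: "\<And>b. b \<in> B \<Longrightarrow> code (c b) \<and> b = elt (c b)" by metis
  then have "B \<subseteq> hull (\<Union>b\<in>B. params (c b))" by (fastforce simp: hull_def)
  then show thesis using that[of "\<Union>b\<in>B. params (c b)"] assms(1) by auto
qed

text \<open>The indiscernible set inside the hull; it bounds the cardinality of the model from
  below.\<close>

definition generator :: "'x \<Rightarrow> 'x" where
  "generator x = elt (Eq (Var 0) (Var 1), [x])"

lemma generator: "range generator \<subseteq> hull UNIV" "inj generator"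
proof -
  have sol: "solutions C (inst h (Eq (Var 0) (Var 1), [x])) = {morley_seq (h x)}" for h and x :: 'x
    using morley_seq_in_univ by (auto simp: solutions_def inst_def holds_def)
  have code: "code (Eq (Var 0) (Var 1), [x])" for x :: 'x
    using sol[of _ x] by (auto simp: code_def pformulas_def formulas_def)
  then show "range generator \<subseteq> hull UNIV" by (auto simp: hull_def generator_def)
  show "inj generator"
  proof (rule injI)
    fix x y assume "generator x = generator y"
    then have same: "same_denotation (Eq (Var 0) (Var 1), [x]) (Eq (Var 0) (Var 1), [y])"
      using elt_eq_iff[OF code code] by (simp add: generator_def)
    obtain h :: "_ \<Rightarrow> nat" where h: "inj_on h {x, y}" using finite_inj_nat[of "{x, y}"] by auto
    have "morley_seq (h x) = morley_seq (h y)"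
      using same h sol by (simp add: same_denotation_def denotation_def insert_commute)
    then show "x = y" using inj_morley_seq h by (auto dest: injD inj_onD)
  qed
qed

text \<open>The point \<open>y\<close> denoted by \<open>\<theta>\<close> does not realise \<open>p\<close> over \<open>S\<close>, so the parameters of \<open>\<theta>\<close>
  outside \<open>S\<close> form a Morley sequence over \<open>S \<union> {y}\<close>.  Replacing them by any other elements outside
  \<open>S\<close> hence does not change the denotation.\<close>

lemma code_with_parameters_in:
  assumes "finite S" "\<delta> \<in> pformulas L S" "\<And>h. inj_on h S \<Longrightarrow> inst h \<delta> \<notin> p"
    and "code \<theta>" "\<And>h. inj_on h (S \<union> params \<theta>) \<Longrightarrow> denotation h \<theta> \<in> solutions C (inst h \<delta>)"
    and "S \<subseteq> S'" "infinite S'"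
  shows "elt \<theta> \<in> hull S'"
proof -
  obtain \<psi> xs where \<theta>: "\<theta> = (\<psi>, xs)" by force
  obtain zs where zs: "set zs = set xs - S" "distinct zs"
    using finite_distinct_list[of "set xs - S"] by auto
  \<comment> \<open>The replacements may meet the old parameters: what matters is distinctness
    inside each list and avoidance of \<open>S\<close>.\<close>
  have "infinite (S' - S)" using assms(1,7) by simp
  then obtain Z where "Z \<subseteq> S' - S" "finite Z" "card Z = length zs"
    using infinite_arbitrarily_large by metis
  then obtain zs' where zs': "set zs' \<subseteq> S' - S" "distinct zs'" "length zs' = length zs"
    using finite_distinct_list[of Z] distinct_card by metis
  define r where "r x = (if x \<in> S then x else the (map_of (zip zs zs') x))" for x
  have r_zs: "map r zs = zs'"
  proof (rule nth_equalityI)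
    fix i assume "i < length (map r zs)"
    then have i: "i < length zs" by simp
    then have "zs ! i \<notin> S" using zs(1) nth_mem by blast
    then show "map r zs ! i = zs' ! i" using i zs(2) zs'(3) by (simp add: r_def map_of_zip_nth)
  qed (use zs'(3) in simp)
  define \<theta>' where "\<theta>' = (\<psi>, map r xs)"
  \<comment> \<open>\<open>U\<close> contains the old and the new parameters, so one injection
    evaluates both codes.\<close>
  define U where "U = S \<union> set xs \<union> set zs'"
  have "finite U" using assms(1) by (simp add: U_def)
  then obtain h :: "_ \<Rightarrow> nat" where h: "inj_on h U" by (rule finite_inj_nat)
  have hS: "inj_on h S" "inj_on h (set xs)" "inj_on h (S \<union> params \<theta>)"
    using h by (auto simp: U_def \<theta> intro: inj_on_subset)
  define y where "y = denotation h \<theta>"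
  define A where "A = morley_seq ` h ` S"
  have A: "finite A" "A \<subseteq> univ C" using assms(1) morley_seq_in_univ by (auto simp: A_def)
  have y: "y \<in> solutions C (inst h \<delta>)" "y \<in> univ C"
    using assms(5)[OF hS(3)] solutions_subset[of C "inst h \<delta>"] by (auto simp: y_def)
  have not_real: "\<not> realises C y (p \<restriction>\<restriction> A)"
  proof
    assume "realises C y (p \<restriction>\<restriction> A)"
    moreover have "inst h \<delta> \<in> pformulas L A" unfolding A_def by (rule inst_in_pformulas[OF assms(2)])
    ultimately have "inst h \<delta> \<in> p"
      using holds_realisation[of y A "fst (inst h \<delta>)" "snd (inst h \<delta>)"] A(2) y(1)
      by (auto simp: solutions_def split: prod.splits)
    then show False using assms(3)[OF hS(1)] by blast
  qed
  have morley: "morley_list (insert y A) (map (\<lambda>x. morley_seq (h x)) ws)"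
    if "distinct ws" "set ws \<inter> S = {}" "set ws \<subseteq> U" for ws
  proof (rule morley_list_insert[OF A y(2) not_real])
    have "inj_on h (S \<union> set ws)" using that(3) by (intro inj_on_subset[OF h]) (auto simp: U_def)
    then have "distinct (map h ws)" "set (map h ws) \<inter> h ` S = {}"
      using that(1,2) by (auto simp: distinct_map inj_on_Un inj_on_def)
    then show "morley_list A (map (\<lambda>x. morley_seq (h x)) ws)"
      using morley_list_morley_seq[of "h ` S" "map h ws"] assms(1) by (simp add: A_def comp_def)
  qed
  have ml: "morley_list (insert y A) (map (\<lambda>x. morley_seq (h x)) zs)"
    "morley_list (insert y A) (map (\<lambda>x. morley_seq (h x)) zs')"
    by (rule morley; use zs zs' in \<open>auto simp: U_def\<close>)+
  have "finite (insert y A)" "insert y A \<subseteq> univ C"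
    "length (map (\<lambda>x. morley_seq (h x)) zs) = length (map (\<lambda>x. morley_seq (h x)) zs')"
    using A y(2) zs'(3) by auto
  note yA = this
  \<comment> \<open>Both lists are Morley sequences over \<open>insert y A\<close>, so
    \<open>y\<close> stays fixed while the parameters are exchanged: the new code defines
    \<open>\<sigma> y\<close>, which is \<open>y\<close>.\<close>
  obtain \<sigma> where \<sigma>: "automorphism L C \<sigma>" "\<And>b. b \<in> insert y A \<Longrightarrow> \<sigma> b = b"
    "map \<sigma> (map (\<lambda>x. morley_seq (h x)) zs) = map (\<lambda>x. morley_seq (h x)) zs'"
    by (rule automorphism_morley_list[OF yA(1,2) ml yA(3)]) (rule that; blast)
  have \<sigma>_r: "\<sigma> (morley_seq (h x)) = morley_seq (h (r x))" if "x \<in> set xs" for x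
  proof (cases "x \<in> S")
    case True
    then show ?thesis using \<sigma>(2) by (simp add: r_def A_def)
  next
    case False
    then have "x \<in> set zs" using that zs(1) by blast
    then show ?thesis using \<sigma>(3) unfolding r_zs[symmetric] by simp
  qed
  have r_in: "r x \<in> S' \<and> r x \<in> U" if "x \<in> set xs" for x
  proof (cases "x \<in> S")
    case True
    then show ?thesis using assms(6) by (auto simp: r_def U_def)
  next
    case False
    then have "r x \<in> set zs'" using that zs(1) unfolding r_zs[symmetric] by simp
    then show ?thesis using zs'(1) by (auto simp: U_def)
  qed
  have pf: "\<theta> \<in> pformulas L UNIV" using assms(4) by (simp add: code_def)
  have "solutions C (inst (\<lambda>x. h (r x)) \<theta>) = \<sigma> ` solutions C (inst h \<theta>)"
    by (rule solutions_inst_automorphism[OF \<sigma>(1) _ pf]) (use \<sigma>_r in \<open>simp add: \<theta>\<close>)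
  also have "solutions C (inst h \<theta>) = {y}"
    using solutions_code[OF assms(4)] hS(2) by (simp add: \<theta> y_def)
  also have "inst (\<lambda>x. h (r x)) \<theta> = inst h \<theta>'" by (simp add: inst_def \<theta> \<theta>'_def)
  finally have sol: "solutions C (inst h \<theta>') = {y}" using \<sigma>(2) by simp
  have sub: "params \<theta>' \<subseteq> U" "params \<theta>' \<subseteq> S'" using r_in by (auto simp: \<theta>'_def)
  have "\<theta>' \<in> pformulas L UNIV" using pf by (simp add: pformulas_def \<theta> \<theta>'_def)
  then have code: "code \<theta>'" using sol inj_on_subset[OF h sub(1)] by (auto simp: code_def)
  have "denotation h \<theta>' = denotation h \<theta>" unfolding y_def[symmetric]
    using sol by (simp add: denotation_def)
  then have "elt \<theta>' = elt \<theta>"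
    unfolding elt_eq_iff[OF code assms(4)]
    using same_denotation_iff[OF \<open>finite U\<close> h code assms(4) sub(1)] by (auto simp: U_def \<theta>)
  then show ?thesis using code sub(2) by (auto simp: hull_def intro: rev_image_eqI)
qed

lemma countable_hull: "countable S \<Longrightarrow> countable (hull S)"
proof -
  assume "countable S"
  then have "countable {\<theta>. code \<theta> \<and> params \<theta> \<subseteq> S}"
    by (rule countable_subset[OF _ countable_pformulas[OF countable_language], rotated])
      (auto simp: code_def pformulas_def)
  then show ?thesis by (simp add: hull_def)
qed

text \<open>All points of \<open>D\<close> are redefined with parameters from \<open>S\<close> and
  one countably infinite set, the same for all of them; the hull of these is countable because
  \<open>L\<close> is.\<close>

lemma countable_definable:
  assumes "finite S" "\<delta> \<in> pformulas L S" "\<And>h. inj_on h S \<Longrightarrow> inst h \<delta> \<notin> p"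
    and "D \<subseteq> hull UNIV" "\<And>\<theta> h. code \<theta> \<Longrightarrow> elt \<theta> \<in> D \<Longrightarrow> inj_on h (S \<union> params \<theta>) \<Longrightarrow>
      denotation h \<theta> \<in> solutions C (inst h \<delta>)"
  shows "countable D"
proof -
  have "infinite (UNIV :: 'x set)" using uncountable_index countable_finite by blast
  then obtain f :: "nat \<Rightarrow> 'x" where f: "inj f" using infinite_countable_subset by blast
  let ?S = "S \<union> range f"
  have "infinite ?S" using f finite_imageD by (auto dest: range_inj_infinite)
  have "elt \<theta> \<in> hull ?S" if "code \<theta>" "elt \<theta> \<in> D" for \<theta>
    by (rule code_with_parameters_in[OF assms(1,2,3) that(1)])
      (use that assms(5) \<open>infinite ?S\<close> in auto)
  then have "D \<subseteq> hull ?S" using assms(4) by (auto simp: hull_def)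
  moreover have "countable (hull ?S)"
    by (rule countable_hull) (use assms(1) countable_finite in auto)
  ultimately show ?thesis using countable_subset by blast
qed

lemma quasiminimal_model:
  "\<exists>N :: ('f, 'r, 'x) fo_struct. model L T N \<and> quasiminimal L N \<and> |UNIV :: 'x set| \<le>o |univ N|"
proof -
  obtain N where N: "is_structure L N" "univ N = hull UNIV"
    and el: "\<And>S h as \<phi>. finite S \<Longrightarrow> inj_on h S \<Longrightarrow> set as \<subseteq> hull S \<Longrightarrow>
      \<phi> \<in> formulas L (length as) \<Longrightarrow> holds N \<phi> as \<longleftrightarrow> holds C \<phi> (map (view (S, h)) as)"
    by (rule hull_structure) (rule that; blast)
  have "holds N \<phi> []" if "\<phi> \<in> T" for \<phi>
  proof -
    have "\<phi> \<in> formulas L 0" using complete_theory that by (auto simp: complete_theory_def)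
    \<comment> \<open>Sentences are compared through the empty parameter set, on which any map is
      injective.\<close>
    then have "holds N \<phi> [] \<longleftrightarrow> holds C \<phi> []" using el[of "{}" undefined "[]" \<phi>] by simp
    then show ?thesis using model that by (simp add: model_def)
  qed
  then have model_N: "model L T N" using N(1) by (simp add: model_def)
  have card: "|UNIV :: 'x set| \<le>o |univ N|"
    using generator card_of_ordLeq N(2) by metis
  have uncountable: "uncountable (univ N)"
    using generator uncountable_index N(2) by (metis countable_image_inj_eq countable_subset)
  have "countable D \<or> countable (univ N - D)" if "definable_subset L N D" for D
  proof -
    obtain \<phi> bs where \<phi>: "(\<phi>, bs) \<in> pformulas L (hull UNIV)" "D = solutions N (\<phi>, bs)"
      using \<open>definable_subset L N D\<close> by (auto simp: definable_subset_def N(2))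
    then have "finite (set bs)" "set bs \<subseteq> hull UNIV" by (auto simp: pformulas_def)
    then obtain S where S: "finite S" "set bs \<subseteq> hull S" by (rule hull_of_elements)
    obtain h0 :: "_ \<Rightarrow> nat" where h0: "inj_on h0 S" by (rule finite_inj_nat[OF S(1)])
    have D: "D \<subseteq> hull UNIV" using \<phi>(2) solutions_subset[of N] N(2) by blast
    \<comment> \<open>The parameters \<open>bs\<close> are hull elements, not generators. In the
      view they are definable from the Morley sequence, so they can be eliminated in favour of
      parameters named in \<open>S\<close>.\<close>
    have "(\<phi>, map (view (S, h0)) bs) \<in> pformulas L (dcl L C (morley_seq ` h0 ` S))"
      using \<phi>(1) S(2) view_hull[OF S(1) h0] by (auto simp: pformulas_def)
    then obtain \<chi> cs where cs: "(\<chi>, cs) \<in> pformulas L (morley_seq ` h0 ` S)"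
      "solutions C (\<chi>, cs) = solutions C (\<phi>, map (view (S, h0)) bs)"
      using definable_over_dcl by fastforce
    then have "cs \<in> lists ((\<lambda>x. morley_seq (h0 x)) ` S)" by (auto simp: pformulas_def)
    then obtain ds where ds: "set ds \<subseteq> S" "cs = map (\<lambda>x. morley_seq (h0 x)) ds"
      unfolding lists_image by auto
    have \<delta>: "(\<chi>, ds) \<in> pformulas L S" "(Neg \<chi>, ds) \<in> pformulas L S"
      using cs(1) ds by (auto simp: pformulas_def)
    have inst: "inst h0 (\<chi>, ds) = (\<chi>, cs)" using ds(2) by (simp add: inst_def)
    \<comment> \<open>The injection \<open>h\<close> is arbitrary and need not extend
      \<open>h0\<close>; an automorphism that matches the two on \<open>S\<close> carries the set
      defined by \<open>\<chi>\<close> along.\<close>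
    have mem: "elt \<theta> \<in> D \<longleftrightarrow> denotation h \<theta> \<in> solutions C (inst h (\<chi>, ds))"
      if \<theta>: "code \<theta>" and h: "inj_on h (S \<union> params \<theta>)" for \<theta> h
    proof -
      let ?U = "S \<union> params \<theta>"
      have U: "finite ?U" "S \<subseteq> ?U" using S(1) by auto
      obtain \<sigma> where \<sigma>: "automorphism L C \<sigma>"
        "\<And>x. x \<in> S \<Longrightarrow> \<sigma> (morley_seq (h0 x)) = morley_seq (h x)"
        "\<And>g. g \<in> hull S \<Longrightarrow> view (?U, h) g = \<sigma> (view (S, h0) g)"
        using view_automorphism[OF U h0 h] by metis
      have "elt \<theta> \<in> hull ?U" using \<theta> by (auto simp: hull_def)
      moreover have "set bs \<subseteq> hull ?U" using S(2) hull_mono[OF U(2)] by blast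
      ultimately have "holds N \<phi> (elt \<theta> # bs) \<longleftrightarrow> holds C \<phi> (map (view (?U, h)) (elt \<theta> # bs))"
        using \<phi>(1) by (intro el U h) (auto simp: pformulas_def)
      moreover have "elt \<theta> \<in> univ N" using \<theta> by (auto simp: N(2) hull_def)
      moreover have den: "view (?U, h) (elt \<theta>) = denotation h \<theta>" "denotation h \<theta> \<in> univ C"
        using view_elt[OF U(1) h \<theta>] denotation_in_univ[OF \<theta>] inj_on_subset[OF h] by auto
      ultimately have "elt \<theta> \<in> D \<longleftrightarrow> denotation h \<theta> \<in> solutions C (\<phi>, map (view (?U, h)) bs)"
        by (simp add: \<phi>(2) solutions_def)
      also have "map (view (?U, h)) bs = map \<sigma> (map (view (S, h0)) bs)"
        using \<sigma>(3) S(2) by auto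
      also have "solutions C (\<phi>, map \<sigma> (map (view (S, h0)) bs)) =
          \<sigma> ` solutions C (\<phi>, map (view (S, h0)) bs)"
        using \<phi>(1) S view_in_univ[OF S(1) h0]
        by (intro automorphism_solutions[OF is_structure \<sigma>(1)]) (auto simp: pformulas_def)
      also have "\<dots> = \<sigma> ` solutions C (inst h0 (\<chi>, ds))" unfolding inst cs(2) ..
      also have "\<dots> = solutions C (inst h (\<chi>, ds))"
        by (rule solutions_inst_automorphism[symmetric, OF \<sigma>(1)])
          (use \<sigma>(2) ds(1) \<delta>(1) in \<open>auto simp: pformulas_def\<close>)
      finally show ?thesis .
    qed
    have pf: "(\<chi>, ds) \<in> pformulas L UNIV" using \<delta>(1) by (auto simp: pformulas_def)
    have type: "inst h (\<chi>, ds) \<in> p \<longleftrightarrow> (\<chi>, cs) \<in> p" if "inj_on h S" for h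
      using inst_in_type_iff[OF pf, of h0 h] inst ds(1) inj_on_subset[OF h0] inj_on_subset[OF that]
      by simp
    have Neg_inst: "inst h (Neg \<chi>, ds) \<in> p \<longleftrightarrow> inst h (\<chi>, ds) \<notin> p" for h
      using type_Neg inst_in_pformulas_univ[OF pf, of h] by (simp add: inst_def)
    show ?thesis
    \<comment> \<open>One of \<open>\<chi>\<close> and its negation lies outside \<open>p\<close>,
      and the set which that one defines is countable.\<close>
    proof (cases "(\<chi>, cs) \<in> p")
      case False
      have "countable D"
        by (rule countable_definable[OF S(1) \<delta>(1) _ D]) (use type False mem in auto)
      then show ?thesis ..
    next
      case True
      have "countable (univ N - D)"
      proof (rule countable_definable[OF S(1) \<delta>(2)])
        show "univ N - D \<subseteq> hull UNIV" by (simp add: N(2))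
        show "inst h (Neg \<chi>, ds) \<notin> p" if "inj_on h S" for h
          using Neg_inst type[OF that] True by simp
        fix \<theta> and h :: "'x \<Rightarrow> nat"
        assume *: "code \<theta>" "elt \<theta> \<in> univ N - D" "inj_on h (S \<union> params \<theta>)"
        then have "denotation h \<theta> \<notin> solutions C (inst h (\<chi>, ds))" using mem by blast
        moreover have "denotation h \<theta> \<in> univ C"
          using denotation_in_univ[OF *(1)] inj_on_subset[OF *(3)] by auto
        ultimately show "denotation h \<theta> \<in> solutions C (inst h (Neg \<chi>, ds))"
          by (simp add: inst_def solutions_Neg)
      qed
      then show ?thesis ..
    qed
  qed
  with uncountable have "quasiminimal L N" by (simp add: quasiminimal_def)
  with model_N card show ?thesis by blast
qed

end

section \<open>Codes as elements of a large set\<close>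

text \<open>Iterated pairing encodes lists of a given length injectively; the length is stored
  beside this code to separate lists of different lengths.\<close>

lemma inj_pair_lists:
  assumes "infinite (UNIV :: 'x set)" "countable A"
  shows "\<exists>enc :: 'b \<times> 'x list \<Rightarrow> 'x. inj_on enc (A \<times> UNIV)"
proof -
  have "|UNIV \<times> UNIV :: ('x \<times> 'x) set| \<le>o |UNIV :: 'x set|"
    using card_of_Times_same_infinite[OF assms(1)] ordIso_iff_ordLeq by blast
  then obtain pair :: "'x \<times> 'x \<Rightarrow> 'x" where pair: "inj pair"
    using card_of_ordLeq by (metis UNIV_Times_UNIV)
  obtain n :: "nat \<Rightarrow> 'x" where n: "inj n" using infinite_countable_subset[OF assms(1)] by blast
  define le where "le = rec_list (n 0) (\<lambda>x _ y. pair (x, y))"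
  have le: "le xs = le ys \<Longrightarrow> xs = ys" if "length xs = length ys" for xs ys
    using that by (induction xs ys rule: list_induct2) (auto simp: le_def dest: injD[OF pair])
  define enc where "enc = (\<lambda>(b, xs). pair (n (to_nat_on A b), pair (n (length xs), le xs)))"
  have "inj_on enc (A \<times> UNIV)"
  proof (rule inj_onI, clarify)
    fix b b' xs ys assume "b \<in> A" "b' \<in> A" "enc (b, xs) = enc (b', ys)"
    then have "to_nat_on A b = to_nat_on A b'" "length xs = length ys" "le xs = le ys"
      by (simp_all add: enc_def inj_eq[OF pair] inj_eq[OF n])
    then show "b = b' \<and> xs = ys" using le \<open>b \<in> A\<close> \<open>b' \<in> A\<close> assms(2) by auto
  qed
  then show ?thesis by blast
qed

lemma uncountable_UNIV_sum_nat_set: "uncountable (UNIV :: ('k + nat set) set)"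
proof
  assume "countable (UNIV :: ('k + nat set) set)"
  then have "countable (range (Inr :: nat set \<Rightarrow> 'k + nat set))" by (rule countable_subset[rotated]) simp
  then have "countable (UNIV :: nat set set)" by (rule countable_image_inj_on) simp
  then have "range (from_nat_into (UNIV :: nat set set)) = UNIV" by (rule range_from_nat_into[rotated]) simp
  then show False using Cantors_theorem[of "UNIV :: nat set"] by auto
qed

text \<open>The type variable \<open>'k\<close> is arbitrary, which expresses arbitrarily large
  cardinals. The summand \<open>nat set\<close> keeps the index type, which is also the type of the
  elements, uncountable when \<open>'k\<close> is small.\<close>

theorem theorem4p4:
  fixes L :: "('f, 'r) language"
    and T :: "('f, 'r) fm set"
    and \<kappa> :: "'c rel"
    and C :: "('f, 'r, 'a) fo_struct"
    and p :: "('f, 'r, 'a) pfm set"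
  assumes "countable_language L"
    and "complete_theory L T"
    and "definable_skolem_functions L T"
    and "monster_model L T \<kappa> C"
    and "global_type L C p"
    and "nonalgebraic C p"
    and "strongly_regular L \<kappa> C p"
    and "symmetric_type L C p"
  shows "\<forall>\<mu> :: 'k rel. Card_order \<mu> \<longrightarrow>
           (\<exists>M :: ('f, 'r, 'k + nat set) fo_struct.
              model L T M \<and> quasiminimal L M \<and> \<mu> \<le>o |univ M| )"
proof (intro allI impI)
  fix \<mu> :: "'k rel" assume \<mu>: "Card_order \<mu>"
  have inf: "infinite (UNIV :: ('k + nat set) set)"
    using uncountable_UNIV_sum_nat_set countable_finite by blast
  obtain enc :: "('f, 'r, 'k + nat set) pfm \<Rightarrow> 'k + nat set" where
    "inj_on enc ({\<phi>. wf_fm L \<phi>} \<times> UNIV)"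
    using inj_pair_lists[OF inf countable_wf_fm[OF assms(1)]] by blast
  then have enc: "inj_on enc (pformulas L UNIV)"
    by (rule inj_on_subset) (auto simp: pformulas_def formulas_def)
  interpret skolem_hull L T \<kappa> C p enc
    using assms enc uncountable_UNIV_sum_nat_set by unfold_locales
  obtain M :: "('f, 'r, 'k + nat set) fo_struct" where M: "model L T M" "quasiminimal L M"
    "|UNIV :: ('k + nat set) set| \<le>o |univ M|"
    using quasiminimal_model by blast
  have "\<mu> =o |Field \<mu>|" using card_of_Field_ordIso[OF \<mu>] ordIso_symmetric by blast
  moreover have "|Field \<mu>| \<le>o |UNIV :: ('k + nat set) set|"
    using card_of_ordLeq[of "Field \<mu>" "UNIV :: ('k + nat set) set"] by (metis inj_Inl inj_on_subset subset_UNIV)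
  ultimately have "\<mu> \<le>o |univ M|" using M(3) ordIso_ordLeq_trans ordLeq_transitive by blast
  with M show "\<exists>M :: ('f, 'r, 'k + nat set) fo_struct.
      model L T M \<and> quasiminimal L M \<and> \<mu> \<le>o |univ M|" by blast
qed

end
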